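(* If $n\equiv 2 \bmod 4$ and $k$ is an odd positive integer, then there is a smooth, closed, orientable $n$-manifold on which the dihedral group $D_k$ of order $2k$ acts smoothly, pseudofreely, preserving orientation, with exactly three singular orbits of types $(2,2,k)$.
   Context: $D_k$ denotes the dihedral group of order $2k$ and $C_m$ the cyclic group of order $m$; $D_k$ is the semidirect product of its normal subgroup $C_k$ with $C_2$ acting on $C_k$ by inversion. A group action is pseudofree if the fixed point set of each non-identity element is discrete. A singular orbit is an orbit whose points have nontrivial isotropy group. Three singular orbits of types $(2,2,k)$ means singular orbits with isotropy groups $C_2$, $C_2$, $C_k$, respectively: two orbits with isotropy groups of order $2$ and one orbit with isotropy group $C_k$.
   Formalization: For k = 1 an orbit with isotropy group C_1 is not singular, so three singular orbits of types (2,2,1) cannot exist; in that case the formal statement asserts exactly two singular orbits, both of type 2, together with a free orbit. *)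

theory Defs
  imports
    "HOL-Analysis.Analysis"
    "HOL-Algebra.Group_Action"
    "HOL-Algebra.Elementary_Groups"
begin

section \<open>Smooth functions on open subsets of Euclidean space\<close>

text \<open>Being k times continuously differentiable is expressed through iterated directional
  derivatives, because the type of the k-th total derivative depends on k. Both notions are only
  meant for open sets, where they do not depend on the values of the function elsewhere.\<close>

primrec Ck_on :: "nat \<Rightarrow> 'a::real_normed_vector set \<Rightarrow> ('a \<Rightarrow> 'b::real_normed_vector) \<Rightarrow> bool" where
  "Ck_on 0 S f \<longleftrightarrow> continuous_on S f"
| "Ck_on (Suc k) S f \<longleftrightarrow>
     (\<forall>x\<in>S. f differentiable (at x)) \<and>
     (\<forall>v. Ck_on k S (\<lambda>x. frechet_derivative f (at x) v))"

definition smooth_on :: "'a::real_normed_vector set \<Rightarrow> ('a \<Rightarrow> 'b::real_normed_vector) \<Rightarrow> bool" where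
  "smooth_on S f \<longleftrightarrow> (\<forall>k. Ck_on k S f)"

definition jacobian_det :: "(real^'n \<Rightarrow> real^'n) \<Rightarrow> real^'n \<Rightarrow> real" where
  "jacobian_det f x = det (matrix (frechet_derivative f (at x)))"


section \<open>Smooth manifolds without boundary\<close>

type_synonym ('p, 'n) chart = "'p set \<times> ('p \<Rightarrow> real^'n)"

definition chart_on :: "'p topology \<Rightarrow> ('p, 'n::finite) chart \<Rightarrow> bool" where
  "chart_on X = (\<lambda>(U, f). openin X U \<and> open (f ` U) \<and>
     homeomorphic_map (subtopology X U) (top_of_set (f ` U)) f)"

text \<open>The expression of a map F between two manifolds in charts \<open>(U, f)\<close> and \<open>(V, h)\<close>:
  it is meaningful on the image under f of the points of U that F sends into V.\<close>

definition local_dom :: "('p, 'n) chart \<Rightarrow> ('p \<Rightarrow> 'p) \<Rightarrow> ('p, 'n) chart \<Rightarrow> (real^'n) set" where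
  "local_dom = (\<lambda>(U, f) F (V, h). f ` {p \<in> U. F p \<in> V})"

definition local_rep :: "('p, 'n) chart \<Rightarrow> ('p \<Rightarrow> 'p) \<Rightarrow> ('p, 'n) chart \<Rightarrow> real^'n \<Rightarrow> real^'n" where
  "local_rep = (\<lambda>(U, f) F (V, h). h \<circ> F \<circ> inv_into U f)"

text \<open>Atlases need not be maximal. The transition maps are the local representations of the
  identity.\<close>

definition smooth_atlas :: "'p topology \<Rightarrow> ('p, 'n::finite) chart set \<Rightarrow> bool" where
  "smooth_atlas X A \<longleftrightarrow>
     (\<forall>c\<in>A. chart_on X c) \<and>
     (\<Union>c\<in>A. fst c) = topspace X \<and>
     (\<forall>c\<in>A. \<forall>d\<in>A. smooth_on (local_dom c id d) (local_rep c id d))"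

definition smooth_manifold :: "'p topology \<Rightarrow> ('p, 'n::finite) chart set \<Rightarrow> bool" where
  "smooth_manifold X A \<longleftrightarrow> Hausdorff_space X \<and> second_countable X \<and> smooth_atlas X A"

definition closed_smooth_manifold :: "'p topology \<Rightarrow> ('p, 'n::finite) chart set \<Rightarrow> bool" where
  "closed_smooth_manifold X A \<longleftrightarrow> smooth_manifold X A \<and> compact_space X"

text \<open>An orientation is given by an atlas of the same smooth structure all of whose transition
  maps have positive Jacobian determinant.\<close>

definition orientation_of ::
  "'p topology \<Rightarrow> ('p, 'n::finite) chart set \<Rightarrow> ('p, 'n) chart set \<Rightarrow> bool" where
  "orientation_of X A B \<longleftrightarrow>
     smooth_atlas X B \<and> smooth_atlas X (A \<union> B) \<and>
     (\<forall>c\<in>B. \<forall>d\<in>B. \<forall>x\<in>local_dom c id d. jacobian_det (local_rep c id d) x > 0)"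

definition orientable :: "'p topology \<Rightarrow> ('p, 'n::finite) chart set \<Rightarrow> bool" where
  "orientable X A \<longleftrightarrow> (\<exists>B. orientation_of X A B)"

definition smooth_self_map ::
  "'p topology \<Rightarrow> ('p, 'n::finite) chart set \<Rightarrow> ('p \<Rightarrow> 'p) \<Rightarrow> bool" where
  "smooth_self_map X A F \<longleftrightarrow>
     continuous_map X X F \<and>
     (\<forall>c\<in>A. \<forall>d\<in>A. smooth_on (local_dom c F d) (local_rep c F d))"

definition preserves_orientation :: "('p, 'n::finite) chart set \<Rightarrow> ('p \<Rightarrow> 'p) \<Rightarrow> bool" where
  "preserves_orientation B F \<longleftrightarrow>
     (\<forall>c\<in>B. \<forall>d\<in>B. \<forall>x\<in>local_dom c F d. jacobian_det (local_rep c F d) x > 0)"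


section \<open>Group actions on manifolds\<close>

definition smooth_action ::
  "('g, 'm) monoid_scheme \<Rightarrow> 'p topology \<Rightarrow> ('p, 'n::finite) chart set \<Rightarrow> ('g \<Rightarrow> 'p \<Rightarrow> 'p) \<Rightarrow> bool" where
  "smooth_action G X A \<phi> \<longleftrightarrow>
     group_action G (topspace X) \<phi> \<and> (\<forall>g\<in>carrier G. smooth_self_map X A (\<phi> g))"

definition orientation_preserving_action ::
  "('g, 'm) monoid_scheme \<Rightarrow> 'p topology \<Rightarrow> ('p, 'n::finite) chart set \<Rightarrow> ('g \<Rightarrow> 'p \<Rightarrow> 'p) \<Rightarrow> bool" where
  "orientation_preserving_action G X A \<phi> \<longleftrightarrow>
     (\<exists>B. orientation_of X A B \<and> (\<forall>g\<in>carrier G. preserves_orientation B (\<phi> g)))"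

definition pseudofree_action ::
  "('g, 'm) monoid_scheme \<Rightarrow> 'p topology \<Rightarrow> ('g \<Rightarrow> 'p \<Rightarrow> 'p) \<Rightarrow> bool" where
  "pseudofree_action G X \<phi> \<longleftrightarrow>
     (\<forall>g\<in>carrier G. g \<noteq> \<one>\<^bsub>G\<^esub> \<longrightarrow>
        subtopology X (invariants (topspace X) \<phi> g)
          = discrete_topology (invariants (topspace X) \<phi> g))"

definition singular_orbits ::
  "('g, 'm) monoid_scheme \<Rightarrow> 'p set \<Rightarrow> ('g \<Rightarrow> 'p \<Rightarrow> 'p) \<Rightarrow> 'p set set" where
  "singular_orbits G E \<phi> = {S \<in> orbits G E \<phi>. \<forall>x\<in>S. stabilizer G \<phi> x \<noteq> {\<one>\<^bsub>G\<^esub>}}"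

definition has_cyclic_isotropy ::
  "('g, 'm) monoid_scheme \<Rightarrow> ('g \<Rightarrow> 'p \<Rightarrow> 'p) \<Rightarrow> 'p set \<Rightarrow> nat \<Rightarrow> bool" where
  "has_cyclic_isotropy G \<phi> S m \<longleftrightarrow>
     (\<forall>x\<in>S. G\<lparr>carrier := stabilizer G \<phi> x\<rparr> \<cong> integer_mod_group m)"

text \<open>If every entry of ms is at least 2, this says that there are exactly \<open>length ms\<close> singular
  orbits, and that they have cyclic isotropy groups of the orders listed in ms (with repetition).
  An entry 1 stands for a free orbit, which is not singular; thus type (2,2,k) with k = 1
  means that there are exactly two singular orbits, both with isotropy groups of order 2
  (and a free orbit).\<close>

definition singular_orbits_of_types ::
  "('g, 'm) monoid_scheme \<Rightarrow> 'p set \<Rightarrow> ('g \<Rightarrow> 'p \<Rightarrow> 'p) \<Rightarrow> nat list \<Rightarrow> bool" where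
  "singular_orbits_of_types G E \<phi> ms \<longleftrightarrow>
     (\<exists>Os. length Os = length ms \<and> distinct Os \<and> set Os \<subseteq> orbits G E \<phi> \<and>
        (\<forall>i<length ms. has_cyclic_isotropy G \<phi> (Os ! i) (ms ! i)) \<and>
        singular_orbits G E \<phi> = {Os ! i | i. i < length ms \<and> ms ! i \<noteq> 1})"


section \<open>The dihedral group of order 2k\<close>

text \<open>The semidirect product of the cyclic group of order k with the cyclic group of order 2,
  whose non-trivial element acts by inversion.\<close>

definition dihedral_group :: "nat \<Rightarrow> (int \<times> int) monoid" where
  "dihedral_group k =
     \<lparr>carrier = carrier (integer_mod_group k) \<times> carrier (integer_mod_group 2),
      monoid.mult = (\<lambda>(a, s) (b, t).
        (a \<otimes>\<^bsub>integer_mod_group k\<^esub> (if s = 0 then b else inv\<^bsub>integer_mod_group k\<^esub> b),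
         s \<otimes>\<^bsub>integer_mod_group 2\<^esub> t)),
      one = (\<one>\<^bsub>integer_mod_group k\<^esub>, \<one>\<^bsub>integer_mod_group 2\<^esub>)\<rparr>"

lemma group_dihedral_group: "group (dihedral_group k)"
proof -
  let ?C = "integer_mod_group k"
  interpret C: comm_group ?C by simp
  have c2: "carrier (integer_mod_group 2) = {0, 1}"
    by (auto simp: carrier_integer_mod_group)
  note [simp del] = mult_integer_mod_group inv_integer_mod_group one_integer_mod_group
  note m2 = mult_integer_mod_group [of 2] one_integer_mod_group [of 2]
  show ?thesis
  proof (rule groupI)
    fix x assume "x \<in> carrier (dihedral_group k)"
    then obtain a s where x: "x = (a, s)" "a \<in> carrier ?C" "s = 0 \<or> s = 1"
      by (auto simp: dihedral_group_def c2)
    let ?y = "(if s = 0 then inv\<^bsub>?C\<^esub> a else a, s)"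
    have "?y \<in> carrier (dihedral_group k)" "?y \<otimes>\<^bsub>dihedral_group k\<^esub> x = \<one>\<^bsub>dihedral_group k\<^esub>"
      using x by (auto simp: dihedral_group_def c2 m2)
    then show "\<exists>y\<in>carrier (dihedral_group k). y \<otimes>\<^bsub>dihedral_group k\<^esub> x = \<one>\<^bsub>dihedral_group k\<^esub>"
      by blast
  qed (auto simp: dihedral_group_def c2 m2 C.m_assoc C.inv_mult)
qed

lemma order_dihedral_group: "k > 0 \<Longrightarrow> order (dihedral_group k) = 2 * k"
  by (simp add: order_def dihedral_group_def carrier_integer_mod_group card_cartesian_product)

end

theory Submission
  imports Defs
begin

text \<open>Write \<open>n = 2 r\<close> with \<open>r\<close> odd. The manifold is a disjoint union of two compact pieces in the space
\<open>\<real> \<times> \<complex> \<times> \<complex>\<^sup>r\<close> with coordinates \<open>(t, Y, z)\<close>, each given by one complex and one real equation.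

The piece that carries the isotropy groups of order 2 is \<open>Y^k = 1\<close>, \<open>(t - 5)\<^sup>2 + |z|\<^sup>2 = 1\<close>: a copy of the
\<open>n\<close>-sphere over each \<open>k\<close>-th root of unity. The rotations multiply \<open>Y\<close> by roots of unity, and reflections act by
\<open>(t, Y, z) \<mapsto> (t, cnj Y, - z)\<close> up to rotations. A point is fixed by a reflection only if it is a pole
\<open>z = 0\<close>, \<open>t = 5 \<plusminus> 1\<close>, so the poles form two orbits with isotropy groups of order 2.

The other piece should have two points fixed by the rotations and exchanged by the reflections, and
should be free otherwise. In the linear action on the \<open>n\<close>-sphere in \<open>\<real> \<times> \<complex>\<^sup>r\<close> in which the
rotations multiply \<open>z\<close> by roots of unity and a reflection sends \<open>(t, z)\<close> to \<open>(- t, cnj z)\<close>, a reflection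
fixes a whole sphere, the real points. Surgery along these spheres would remove them, and equations
for a manifold of this kind are found by adding a variable \<open>Y\<close> that is bound to \<open>z\<close> by \<open>z \<cdot> z = Y - Y^(k+1)\<close>,
the Milnor fibre of an \<open>A\<^sub>k\<close> singularity. A root of unity \<open>u\<close> acts by \<open>(t, u\<^sup>2 Y, u z)\<close> and the reflection by
\<open>(- t, cnj Y, cnj z)\<close>. On a fixed point of the reflection \<open>t = 0\<close>, while \<open>z\<close> and \<open>Y\<close> are real with
\<open>|z|\<^sup>2 = Y - Y^(k+1)\<close>; as \<open>k + 1\<close> is even, this forces \<open>0 \<le> Y \<le> 1\<close>. So all such points lie in a small
ball, and the hypersurface \<open>t\<^sup>2 + |z|\<^sup>2 + |Y|\<^sup>2 / 2 = 4\<close> in the Milnor fibre times the line avoids them. As \<open>k\<close>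
is odd, all reflections are conjugate, so none has a fixed point there. A nontrivial rotation fixes
a point only if \<open>z = 0\<close> and \<open>Y = 0\<close>, which leaves \<open>t = \<plusminus> 2\<close>: one orbit with isotropy group the group of rotations.

Both systems of equations are regular; for the first one this is lemma \<open>equation_surjective\<close>. A regular
level set is an oriented manifold (locale \<open>regular_level_set\<close>), and a map of the ambient space that
transforms the equations linearly acts smoothly on it. It preserves the orientation if its
determinant has the same sign as that of the linear map on the values of the equations (lemma
\<open>jacobian_det_local_rep\<close>). Rotations are squares, so both signs are positive. On the values of the equations
a reflection acts by complex conjugation, with determinant \<open>- 1\<close>. On the ambient space its determinant is
\<open>(- 1)^(r + 2)\<close> for the Milnor fibre piece and \<open>(- 1)^(n + 1)\<close> for the spheres: the first is \<open>- 1\<close> because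
\<open>r\<close> is odd, the second because \<open>n\<close> is even.\<close>

section \<open>Calculus of continuously differentiable maps\<close>

lemma Ck_on_subset: "Ck_on k S f \<Longrightarrow> T \<subseteq> S \<Longrightarrow> Ck_on k T f"
  by (induction k arbitrary: f) (auto intro: continuous_on_subset)

lemma Ck_on_cong:
  assumes "open S" "\<And>x. x \<in> S \<Longrightarrow> f x = g x" "Ck_on k S f"
  shows "Ck_on k S g"
  using assms(2,3)
proof (induction k arbitrary: f g)
  case 0
  then show ?case by (simp cong: continuous_on_cong)
next
  case (Suc k)
  have D: "(g has_derivative frechet_derivative f (at x)) (at x)" if "x \<in> S" for x
    using Suc.prems that \<open>open S\<close>
    by (auto intro: has_derivative_transform_within_open simp: frechet_derivative_works)
  have "Ck_on k S (\<lambda>x. frechet_derivative g (at x) v)" for v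
  proof (rule Suc.IH)
    show "Ck_on k S (\<lambda>x. frechet_derivative f (at x) v)" using Suc.prems by simp
    show "frechet_derivative f (at x) v = frechet_derivative g (at x) v" if "x \<in> S" for x
      using frechet_derivative_at[OF D[OF that]] by simp
  qed
  then show ?case using D by (auto simp: differentiable_def)
qed

lemma Ck_on_SucI:
  assumes "open S" "\<And>x. x \<in> S \<Longrightarrow> (f has_derivative f' x) (at x)"
    and "\<And>v. Ck_on k S (\<lambda>x. f' x v)"
  shows "Ck_on (Suc k) S f"
proof -
  have "Ck_on k S (\<lambda>x. frechet_derivative f (at x) v)" for v
    by (rule Ck_on_cong[OF assms(1) _ assms(3)]) (simp add: frechet_derivative_at[OF assms(2)])
  then show ?thesis using assms(2) by (auto simp: differentiable_def)
qed

lemma Ck_on_SucD: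
  assumes "Ck_on (Suc k) S f"
  shows "x \<in> S \<Longrightarrow> (f has_derivative frechet_derivative f (at x)) (at x)"
    and "Ck_on k S (\<lambda>x. frechet_derivative f (at x) v)"
  using assms by (auto simp: frechet_derivative_works)

lemma Ck_on_Suc_imp: "Ck_on (Suc k) S f \<Longrightarrow> Ck_on k S f"
proof (induction k arbitrary: f)
  case 0
  then show ?case
    by (auto intro!: continuous_at_imp_continuous_on differentiable_imp_continuous_within)
next
  case (Suc k)
  from Suc.prems have "\<forall>x\<in>S. f differentiable at x" by (simp del: Ck_on.simps(1))
  moreover have "Ck_on k S (\<lambda>x. frechet_derivative f (at x) v)" for v
    by (rule Suc.IH[OF Ck_on_SucD(2)[OF Suc.prems]])
  ultimately show ?case by simp
qed

lemma Ck_on_const: "Ck_on k S (\<lambda>x. c)"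
  by (induction k arbitrary: c) auto

lemma Ck_on_bounded_linear: "bounded_linear L \<Longrightarrow> Ck_on k S L"
proof (cases k)
  case (Suc m)
  assume L: "bounded_linear L"
  then have "frechet_derivative L (at x) = L" for x
    using bounded_linear_imp_has_derivative frechet_derivative_at by metis
  then show ?thesis using L Suc
    by (auto simp: Ck_on_const bounded_linear_imp_differentiable)
qed (simp add: linear_continuous_on)

lemma Ck_on_add:
  assumes "open S" "Ck_on k S f" "Ck_on k S g"
  shows "Ck_on k S (\<lambda>x. f x + g x)"
  using assms(2,3)
proof (induction k arbitrary: f g)
  case (Suc k)
  show ?case
  proof (rule Ck_on_SucI[OF \<open>open S\<close>])
    show "((\<lambda>x. f x + g x) has_derivative
        (\<lambda>v. frechet_derivative f (at x) v + frechet_derivative g (at x) v)) (at x)"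
      if "x \<in> S" for x
      by (intro has_derivative_add Ck_on_SucD(1)[OF Suc.prems(1)] Ck_on_SucD(1)[OF Suc.prems(2)] that)
    show "Ck_on k S (\<lambda>x. frechet_derivative f (at x) v + frechet_derivative g (at x) v)" for v
      by (intro Suc.IH Ck_on_SucD(2)[OF Suc.prems(1)] Ck_on_SucD(2)[OF Suc.prems(2)])
  qed
qed (auto intro: continuous_on_add)

text \<open>The product rule expresses the derivative of a product through products of maps that are
  one degree less differentiable.\<close>

lemma (in bounded_bilinear) Ck_on:
  assumes "open S" "Ck_on k S f" "Ck_on k S g"
  shows "Ck_on k S (\<lambda>x. prod (f x) (g x))"
  using assms(2,3)
proof (induction k arbitrary: f g)
  case 0
  then show ?case by (simp add: continuous_on)
next
  case (Suc k)
  show ?case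
  proof (rule Ck_on_SucI[OF \<open>open S\<close>])
    show "((\<lambda>x. prod (f x) (g x)) has_derivative (\<lambda>v. prod (f x) (frechet_derivative g (at x) v) +
        prod (frechet_derivative f (at x) v) (g x))) (at x)" if "x \<in> S" for x
      by (intro FDERIV Ck_on_SucD(1)[OF Suc.prems(1)] Ck_on_SucD(1)[OF Suc.prems(2)] that)
    show "Ck_on k S (\<lambda>x. prod (f x) (frechet_derivative g (at x) v) +
        prod (frechet_derivative f (at x) v) (g x))" for v
      by (intro Ck_on_add \<open>open S\<close> Suc.IH Ck_on_SucD(2)[OF Suc.prems(1)]
          Ck_on_SucD(2)[OF Suc.prems(2)] Ck_on_Suc_imp[OF Suc.prems(1)]
          Ck_on_Suc_imp[OF Suc.prems(2)])
  qed
qed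

lemma Ck_on_linear_comp:
  assumes "bounded_linear L" "open S" "Ck_on k S f"
  shows "Ck_on k S (\<lambda>x. L (f x))"
  using assms(3)
proof (induction k arbitrary: f)
  case 0
  then show ?case by (simp add: bounded_linear.continuous_on[OF assms(1)])
next
  case (Suc k)
  show ?case
  proof (rule Ck_on_SucI[OF \<open>open S\<close>])
    show "((\<lambda>x. L (f x)) has_derivative (\<lambda>v. L (frechet_derivative f (at x) v))) (at x)"
      if "x \<in> S" for x
      by (intro bounded_linear.has_derivative[OF assms(1)] Ck_on_SucD(1)[OF Suc.prems] that)
    show "Ck_on k S (\<lambda>x. L (frechet_derivative f (at x) v))" for v
      by (intro Suc.IH Ck_on_SucD(2)[OF Suc.prems])
  qed
qed

lemma Ck_on_sum:
  assumes "open S" "\<And>i. i \<in> I \<Longrightarrow> Ck_on k S (f i)"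
  shows "Ck_on k S (\<lambda>x. \<Sum>i\<in>I. f i x)"
  using assms(2)
  by (induction I rule: infinite_finite_induct) (auto simp: Ck_on_const Ck_on_add assms(1))

lemma Ck_on_prod:
  fixes f :: "'i \<Rightarrow> 'a::real_normed_vector \<Rightarrow> real"
  assumes "open S" "\<And>i. i \<in> I \<Longrightarrow> Ck_on k S (f i)"
  shows "Ck_on k S (\<lambda>x. \<Prod>i\<in>I. f i x)"
  using assms(2)
  by (induction I rule: infinite_finite_induct)
    (auto simp: Ck_on_const bounded_bilinear.Ck_on[OF bounded_bilinear_mult assms(1)])

lemma Ck_on_inverse:
  fixes f :: "'a::real_normed_vector \<Rightarrow> real"
  assumes "open S" "\<And>x. x \<in> S \<Longrightarrow> f x \<noteq> 0" "Ck_on k S f"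
  shows "Ck_on k S (\<lambda>x. inverse (f x))"
  using assms(3)
proof (induction k)
  case 0
  then show ?case using assms(2) by (auto intro: continuous_on_inverse)
next
  case (Suc k)
  note mult = bounded_bilinear.Ck_on[OF bounded_bilinear_mult \<open>open S\<close>]
  have inv: "Ck_on k S (\<lambda>x. inverse (f x))" by (rule Suc.IH[OF Ck_on_Suc_imp[OF Suc.prems]])
  have "Ck_on k S (\<lambda>x. (- 1) * (inverse (f x) * frechet_derivative f (at x) v * inverse (f x)))" for v
    by (intro mult Ck_on_const inv Ck_on_SucD(2)[OF Suc.prems])
  then show ?case
  proof (rule Ck_on_SucI[OF \<open>open S\<close>, rotated])
    show "((\<lambda>x. inverse (f x)) has_derivative
        (\<lambda>v. (- 1) * (inverse (f x) * frechet_derivative f (at x) v * inverse (f x)))) (at x)"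
      if "x \<in> S" for x
      using Deriv.has_derivative_inverse[OF assms(2)[OF that] Ck_on_SucD(1)[OF Suc.prems that]]
      by simp
  qed
qed

lemma Ck_on_vec:
  fixes f :: "'a::real_normed_vector \<Rightarrow> real^'n"
  assumes "open S" "\<And>i. Ck_on k S (\<lambda>x. f x $ i)"
  shows "Ck_on k S f"
proof -
  have "Ck_on k S (\<lambda>x. \<Sum>i\<in>UNIV. (f x $ i) *\<^sub>R axis i (1::real))"
    by (intro Ck_on_sum bounded_bilinear.Ck_on[OF bounded_bilinear_scaleR] Ck_on_const assms)
  moreover have "(\<Sum>i\<in>UNIV. (f x $ i) *\<^sub>R axis i (1::real)) = f x" for x
    by (simp add: vec_eq_iff axis_def if_distrib cong: if_cong)
  ultimately show ?thesis by simp
qed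

lemma Ck_on_diff:
  assumes "open S" "Ck_on k S f" "Ck_on k S g"
  shows "Ck_on k S (\<lambda>x. f x - g x)"
  using Ck_on_add[OF assms(1,2)
      Ck_on_linear_comp[OF bounded_linear_minus[OF bounded_linear_ident] assms(1,3)]] by simp

lemma Ck_on_power:
  fixes f :: "'a::real_normed_vector \<Rightarrow> 'b::real_normed_algebra_1"
  assumes "open S" "Ck_on k S f"
  shows "Ck_on k S (\<lambda>x. f x ^ m)"
  by (induction m)
    (simp_all add: Ck_on_const assms bounded_bilinear.Ck_on[OF bounded_bilinear_mult])

lemma Ck_on_Un:
  assumes "open S" "open T"
  shows "Ck_on k S f \<Longrightarrow> Ck_on k T f \<Longrightarrow> Ck_on k (S \<union> T) f"
  by (induction k arbitrary: f) (auto intro: continuous_on_open_Un assms)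

text \<open>In the chain rule the direction of differentiation of the outer map varies with the point.
  Expanding that direction in a basis of the finite-dimensional middle space turns the derivative
  into a sum of products to which the induction hypothesis and the product rule apply.\<close>

lemma Ck_on_compose:
  fixes f :: "'a::real_normed_vector \<Rightarrow> 'b::euclidean_space"
  assumes "open S" "open T" "f ` S \<subseteq> T" "Ck_on k T g" "Ck_on k S f"
  shows "Ck_on k S (\<lambda>x. g (f x))"
  using assms(4,5)
proof (induction k arbitrary: g)
  case 0
  then show ?case using assms(3) by (auto intro: continuous_on_compose2)
next
  case (Suc k)
  have Dg: "(g has_derivative frechet_derivative g (at (f x))) (at (f x))" if "x \<in> S" for x
    using that assms(3) Ck_on_SucD(1)[OF Suc.prems(1)] by blast
  show ?case
  proof (rule Ck_on_SucI[OF \<open>open S\<close>])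
    fix x assume "x \<in> S"
    show "((\<lambda>x. g (f x)) has_derivative
        (\<lambda>v. frechet_derivative g (at (f x)) (frechet_derivative f (at x) v))) (at x)"
      using has_derivative_compose[OF Ck_on_SucD(1)[OF Suc.prems(2) \<open>x \<in> S\<close>] Dg[OF \<open>x \<in> S\<close>]]
      by simp
  next
    fix v
    have "Ck_on k S (\<lambda>x. \<Sum>b\<in>Basis. (frechet_derivative f (at x) v \<bullet> b) *\<^sub>R
        frechet_derivative g (at (f x)) b)"
      by (intro Ck_on_sum \<open>open S\<close> bounded_bilinear.Ck_on[OF bounded_bilinear_scaleR] Suc.IH
          Ck_on_SucD(2)[OF Suc.prems(1)] Ck_on_Suc_imp[OF Suc.prems(2)]
          Ck_on_linear_comp[OF bounded_linear_inner_left] Ck_on_SucD(2)[OF Suc.prems(2)])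
    then show "Ck_on k S (\<lambda>x. frechet_derivative g (at (f x)) (frechet_derivative f (at x) v))"
    proof (rule Ck_on_cong[OF \<open>open S\<close>, rotated])
      fix x assume "x \<in> S"
      then interpret linear "frechet_derivative g (at (f x))"
        using Dg has_derivative_linear by blast
      show "(\<Sum>b\<in>Basis. (frechet_derivative f (at x) v \<bullet> b) *\<^sub>R frechet_derivative g (at (f x)) b) =
          frechet_derivative g (at (f x)) (frechet_derivative f (at x) v)"
        by (simp flip: scaleR sum add: euclidean_representation)
    qed
  qed
qed

lemma Ck_on_det:
  fixes A :: "'a::real_normed_vector \<Rightarrow> real^'n^'n"
  assumes "open S" "\<And>i j. Ck_on k S (\<lambda>x. A x $ i $ j)"
  shows "Ck_on k S (\<lambda>x. det (A x))"
  unfolding det_def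
  by (intro Ck_on_sum Ck_on_prod assms bounded_bilinear.Ck_on[OF bounded_bilinear_mult] Ck_on_const)

section \<open>Smooth local inverses\<close>

text \<open>By Cramer's rule the derivative of the inverse is a rational expression in the first
  derivatives of the given map at the preimage, so every degree of differentiability of the
  inverse yields the next one.\<close>

lemma Ck_on_inverse_map:
  fixes f g :: "real^'n \<Rightarrow> real^'n"
  assumes "open S" "open T" "g ` T \<subseteq> S" and f: "\<And>k. Ck_on k S f"
    and dg: "\<And>y. y \<in> T \<Longrightarrow> (g has_derivative g' y) (at y)"
    and inv: "\<And>y v. y \<in> T \<Longrightarrow> frechet_derivative f (at (g y)) (g' y v) = v"
  shows "Ck_on k T g"
proof (induction k)
  case 0
  then show ?case
    by (auto intro!: continuous_at_imp_continuous_on has_derivative_continuous dg)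
next
  case (Suc k)
  define A where "A y = matrix (frechet_derivative f (at (g y)))" for y
  have lin: "linear (frechet_derivative f (at (g y)))" if "y \<in> T" for y
    using Ck_on_SucD(1)[OF f] that assms(3) has_derivative_linear by blast
  have A: "A y *v x = frechet_derivative f (at (g y)) x" if "y \<in> T" for y x
    unfolding A_def using lin[OF that] by (simp add: matrix_works)
  have det: "det (A y) \<noteq> 0" if "y \<in> T" for y
  proof -
    have "surj ((*v) (A y))"
      by (rule surjI[where f="g' y"]) (simp add: A inv that)
    then show ?thesis
      by (simp add: invertible_det_nz[symmetric] invertible_right_inverse
          matrix_right_invertible_surjective)
  qed
  have cA: "Ck_on k T (\<lambda>y. A y $ i $ j)" for i j
  proof -
    have "Ck_on k T (\<lambda>y. frechet_derivative f (at (g y)) (axis j 1))"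
      by (rule Ck_on_compose[OF \<open>open T\<close> \<open>open S\<close> \<open>g ` T \<subseteq> S\<close> _ Suc.IH])
        (rule Ck_on_SucD(2)[OF f])
    from Ck_on_linear_comp[OF bounded_linear_vec_nth \<open>open T\<close> this]
    show ?thesis by (simp add: A_def matrix_def)
  qed
  have "Ck_on k T (\<lambda>y. g' y v)" for v
  proof (rule Ck_on_vec[OF \<open>open T\<close>])
    fix i
    have "Ck_on k T (\<lambda>y. det (\<chi> r c. if c = i then v $ r else A y $ r $ c) * inverse (det (A y)))"
    proof (intro bounded_bilinear.Ck_on[OF bounded_bilinear_mult \<open>open T\<close>]
          Ck_on_inverse Ck_on_det \<open>open T\<close> cA det)
      fix r c show "Ck_on k T (\<lambda>y. (\<chi> r c. if c = i then v $ r else A y $ r $ c) $ r $ c)"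
        by (cases "c = i") (auto simp: Ck_on_const cA)
    qed
    then show "Ck_on k T (\<lambda>y. g' y v $ i)"
    proof (rule Ck_on_cong[OF \<open>open T\<close>, rotated])
      fix y assume "y \<in> T"
      then have "A y *v g' y v = v" by (simp add: A inv)
      then show "det (\<chi> r c. if c = i then v $ r else A y $ r $ c) * inverse (det (A y)) = g' y v $ i"
        using cramer[OF det[OF \<open>y \<in> T\<close>]] by (simp add: divide_inverse)
    qed
  qed
  with dg show ?case by (intro Ck_on_SucI[OF \<open>open T\<close>])
qed

lemma smooth_on_jacobian_entry:
  assumes "open S" "smooth_on S f"
  shows "Ck_on k S (\<lambda>x. matrix (frechet_derivative f (at x)) $ i $ j)"
proof -
  have "Ck_on (Suc k) S f" using assms(2) unfolding smooth_on_def ..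
  from Ck_on_linear_comp[OF bounded_linear_vec_nth \<open>open S\<close> Ck_on_SucD(2)[OF this]]
  show ?thesis by (simp add: matrix_def)
qed

text \<open>The inverse function theorem supplies a differentiable local inverse, which is smooth by
\<open>Ck_on_inverse_map\<close>, and shrinking the neighbourhood keeps the Jacobian determinant
positive, which is how orientations enter below.\<close>
lemma local_diffeomorphism:
  fixes H :: "real^'n \<Rightarrow> real^'n"
  assumes "open S" "smooth_on S H" "p \<in> S" "jacobian_det H p > 0"
  obtains U where "open U" "p \<in> U" "U \<subseteq> S" "inj_on H U" "open (H ` U)"
    "smooth_on (H ` U) (inv_into U H)" "\<And>q. q \<in> U \<Longrightarrow> jacobian_det H q > 0"
proof -
  define S' where "S' = {q \<in> S. jacobian_det H q > 0}"
  have Ck: "Ck_on k S H" for k using assms(2) by (simp add: smooth_on_def)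
  have dH: "(H has_derivative frechet_derivative H (at x)) (at x)" if "x \<in> S" for x
    using Ck_on_SucD(1)[OF Ck that] .
  have "continuous_on S (jacobian_det H)"
    using Ck_on_det[OF \<open>open S\<close> smooth_on_jacobian_entry[OF \<open>open S\<close> assms(2), of 0]]
    by (simp add: jacobian_det_def[abs_def])
  then have "open S'"
    using continuous_open_preimage[OF _ \<open>open S\<close> open_greaterThan, of "jacobian_det H" 0]
    by (simp add: S'_def vimage_def Int_def)
  define f' where "f' x = Blinfun (frechet_derivative H (at x))" for x
  have f': "blinfun_apply (f' x) = frechet_derivative H (at x)" if "x \<in> S" for x
    unfolding f'_def using dH[OF that] has_derivative_bounded_linear
    by (blast intro: bounded_linear_Blinfun_apply)
  have "continuous_on S (\<lambda>x. blinfun_apply (f' x) i)" for i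
    using Ck_on_SucD(2)[OF Ck, of 0 i] by (simp add: f' cong: continuous_on_cong)
  then have cont: "continuous_on S' f'"
    by (intro continuous_on_blinfun_componentwise) (auto simp: S'_def intro: continuous_on_subset)
  have lin: "linear (frechet_derivative H (at x))" if "x \<in> S" for x
    using dH[OF that] has_derivative_linear by blast
  obtain h where h: "linear h" "h \<circ> frechet_derivative H (at p) = id"
  proof -
    have "inj (frechet_derivative H (at p))"
      using assms(4) lin[OF \<open>p \<in> S\<close>] det_nz_iff_inj[OF lin[OF \<open>p \<in> S\<close>]]
      by (simp add: jacobian_det_def)
    then show ?thesis using linear_injective_left_inverse[OF lin[OF \<open>p \<in> S\<close>]] that by blast
  qed
  have inv_h: "Blinfun h o\<^sub>L f' p = id_blinfun"
    using h by (intro blinfun_eqI)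
      (simp add: bounded_linear_Blinfun_apply linear_conv_bounded_linear f' \<open>p \<in> S\<close> pointfree_idE)
  have "(H has_derivative blinfun_apply (f' x)) (at x)" if "x \<in> S'" for x
    using that dH f' by (simp add: S'_def)
  moreover have "p \<in> S'" using assms(3,4) by (simp add: S'_def)
  ultimately obtain U V g g' where *: "open U" "U \<subseteq> S'" "p \<in> U" "open V" "homeomorphism U V H g"
    "\<And>y. y \<in> V \<Longrightarrow> (g has_derivative (g' y)) (at y)"
    "\<And>y. y \<in> V \<Longrightarrow> g' y = inv_into UNIV (blinfun_apply (f'(g y)))"
    "\<And>y. y \<in> V \<Longrightarrow> bij (blinfun_apply (f'(g y)))"
    using inverse_function_theorem[OF \<open>open S'\<close> _ cont _ inv_h] by metis
  have V: "V = H ` U" and gV: "g ` V = U" using *(5) by (auto simp: homeomorphism_def)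
  have inj: "inj_on H U" using *(5) by (metis homeomorphism_def inj_on_inverseI)
  have gi: "g y = inv_into U H y" if "y \<in> V" for y
    using inv_into_f_f[OF inj, of "g y"] that gV *(5) by (auto simp: homeomorphism_def)
  have "smooth_on (H ` U) g"
    unfolding smooth_on_def V[symmetric]
  proof
    fix k show "Ck_on k V g"
    proof (rule Ck_on_inverse_map[OF \<open>open S\<close> \<open>open V\<close> _ Ck *(6)])
      show "g ` V \<subseteq> S" using gV *(2) by (auto simp: S'_def)
      then show "frechet_derivative H (at (g y)) (g' y v) = v" if "y \<in> V" for y v
        using that *(7,8)[OF that] f'[of "g y"] by (simp add: bij_is_surj image_subset_iff surj_f_inv_f)
    qed
  qed
  then have "smooth_on (H ` U) (inv_into U H)"
    using Ck_on_cong[OF \<open>open V\<close> gi] by (simp add: V smooth_on_def)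
  with that[of U] * inj V show ?thesis by (auto simp: S'_def)
qed

section \<open>Determinants of block triangular matrices\<close>

text \<open>The block diagonal matrix with the block \<open>A\<close> on the indices in the range of \<open>\<iota>\<close> and the identity on the
others. Taking \<open>Inl\<close> and \<open>Inr\<close> for \<open>\<iota>\<close> yields the two factors of a block diagonal matrix.\<close>
definition extend_matrix :: "('b \<Rightarrow> 'c) \<Rightarrow> real^'b^'b \<Rightarrow> real^'c^'c" where
  "extend_matrix \<iota> A = (\<chi> i j. if i \<in> range \<iota> \<and> j \<in> range \<iota>
     then A $ inv_into UNIV \<iota> i $ inv_into UNIV \<iota> j else of_bool (i = j))"

lemma det_shear:
  assumes "m \<noteq> (n::'n::finite)"
  shows "det ((\<chi> i j. if i = m \<and> j = n then c else of_bool (i = j)) :: real^'n^'n) = 1"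
proof -
  have "(\<chi> k. if k = m then row m (mat 1) + c *s row n (mat 1) else row k (mat 1)) =
      ((\<chi> i j. if i = m \<and> j = n then c else of_bool (i = j)) :: real^'n^'n)"
    using assms by (auto simp: vec_eq_iff row_def mat_def)
  then show ?thesis using det_row_operation[OF assms, of "mat 1" c] by simp
qed

lemma det_transposition:
  assumes "m \<noteq> (n::'n::finite)"
  shows "det ((\<chi> i j. mat 1 $ i $ Transposition.transpose m n j) :: real^'n^'n) = - 1"
  using det_permute_columns[OF permutes_swap_id[OF UNIV_I UNIV_I], of "mat 1 :: real^'n^'n" m n] assms
  by (simp add: sign_swap_id)

text \<open>Both sides are multiplicative in \<open>A\<close>, so it suffices to compare them on elementary matrices.\<close>
lemma det_extend_matrix:
  fixes \<iota> :: "'b::finite \<Rightarrow> 'c::finite"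
  assumes "inj \<iota>"
  shows "det (extend_matrix \<iota> A) = det A"
proof (induction A rule: induct_matrix_elementary)
  case (1 A B)
  have "extend_matrix \<iota> (A ** B) = extend_matrix \<iota> A ** extend_matrix \<iota> B"
  proof -
    have "extend_matrix \<iota> (A ** B) $ i $ j =
        (\<Sum>k\<in>UNIV. extend_matrix \<iota> A $ i $ k * extend_matrix \<iota> B $ k $ j)" for i j
    proof (cases "i \<in> range \<iota>")
      case True
      then obtain a where i: "i = \<iota> a" by blast
      have "(\<Sum>k\<in>UNIV. extend_matrix \<iota> A $ i $ k * extend_matrix \<iota> B $ k $ j) =
          (\<Sum>k\<in>range \<iota>. extend_matrix \<iota> A $ i $ k * extend_matrix \<iota> B $ k $ j)"
        by (rule sum.mono_neutral_right) (auto simp: extend_matrix_def i)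
      also have "\<dots> = (\<Sum>b\<in>UNIV. extend_matrix \<iota> A $ i $ \<iota> b * extend_matrix \<iota> B $ \<iota> b $ j)"
        by (simp add: sum.reindex[OF assms])
      also have "\<dots> = extend_matrix \<iota> (A ** B) $ i $ j"
        by (auto simp: extend_matrix_def i assms matrix_matrix_mult_def intro!: sum.neutral)
      finally show ?thesis by simp
    next
      case False
      then have "extend_matrix \<iota> C $ i $ k = of_bool (i = k)" for C k
        by (simp add: extend_matrix_def)
      then show ?thesis by (simp add: of_bool_def mult_delta_left)
    qed
    then show ?thesis by (simp add: vec_eq_iff matrix_matrix_mult_def)
  qed
  with 1 show ?case by (simp add: det_mul)
next
  case (2 A i)
  then have "row (\<iota> i) (extend_matrix \<iota> A) = 0"
    by (auto simp: row_def extend_matrix_def vec_eq_iff assms)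
  with 2 show ?case by (metis det_zero_row(2))
next
  case (3 A)
  have "det (extend_matrix \<iota> A) = (\<Prod>i\<in>UNIV. extend_matrix \<iota> A $ i $ i)"
    using 3 by (intro det_diagonal) (auto simp: extend_matrix_def assms inj_eq[OF assms])
  also have "\<dots> = (\<Prod>i\<in>range \<iota>. extend_matrix \<iota> A $ i $ i)"
    by (rule prod.mono_neutral_right) (auto simp: extend_matrix_def)
  also have "\<dots> = det A"
    using 3 by (simp add: prod.reindex[OF assms] det_diagonal extend_matrix_def assms)
  finally show ?case .
next
  case (4 m n)
  have "extend_matrix \<iota> (\<chi> i j. mat 1 $ i $ Transposition.transpose m n j) =
      (\<chi> i j. mat 1 $ i $ Transposition.transpose (\<iota> m) (\<iota> n) j)"
    using assms by (auto simp: extend_matrix_def vec_eq_iff mat_def Transposition.transpose_def inj_eq)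
  moreover have ne: "\<iota> m \<noteq> \<iota> n" using 4 assms by (simp add: inj_eq)
  ultimately show ?case using det_transposition[OF ne] det_transposition[OF 4] by (simp only:)
next
  case (5 m n c)
  have "extend_matrix \<iota> (\<chi> i j. if i = m \<and> j = n then c else of_bool (i = j)) =
      (\<chi> i j. if i = \<iota> m \<and> j = \<iota> n then c else of_bool (i = j))"
    using assms by (auto simp: extend_matrix_def vec_eq_iff inj_eq)
  moreover have ne: "\<iota> m \<noteq> \<iota> n" using 5 assms by (simp add: inj_eq)
  ultimately show ?case using det_shear[OF ne, of c] det_shear[OF 5, of c] by (simp only:)
qed

lemma sum_UNIV_sum_type:
  "(\<Sum>x\<in>(UNIV :: ('a::finite + 'b::finite) set). f x) = (\<Sum>a\<in>UNIV. f (Inl a)) + (\<Sum>b\<in>UNIV. f (Inr b))"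
  using sum.Plus[of "UNIV :: 'a set" "UNIV :: 'b set" f] by simp

lemma prod_UNIV_sum_type:
  "(\<Prod>x\<in>(UNIV :: ('a::finite + 'b::finite) set). f x) = (\<Prod>a\<in>UNIV. f (Inl a)) * (\<Prod>b\<in>UNIV. f (Inr b))"
  using prod.Plus[of "UNIV :: 'a set" "UNIV :: 'b set" f] by simp

text \<open>A permutation that contributes to the determinant preserves the first block of indices, hence
  also the second one, so that the entries below the first block never enter. Without them the
  matrix is a product of two extensions by the identity.\<close>

lemma det_block_triangular:
  fixes A :: "real^('a::finite + 'b::finite)^('a + 'b)"
  assumes "\<And>a b. A $ Inl a $ Inr b = 0"
  shows "det A = det (\<chi> i j. A $ Inl i $ Inl j) * det (\<chi> i j. A $ Inr i $ Inr j)"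
proof -
  define A0 :: "real^('a + 'b)^('a + 'b)" where
    "A0 = (\<chi> i j. if i \<in> range Inr \<and> j \<in> range Inl then 0 else A $ i $ j)"
  have "(\<Prod>i\<in>UNIV. A $ i $ p i) = (\<Prod>i\<in>UNIV. A0 $ i $ p i)"
    if p: "p permutes UNIV" for p
  proof (cases "\<exists>a b. p (Inl a) = Inr b")
    case True
    then obtain a b where "p (Inl a) = Inr b" by blast
    then have "A $ Inl a $ p (Inl a) = 0" "A0 $ Inl a $ p (Inl a) = 0"
      using assms by (auto simp: A0_def)
    then have "(\<Prod>i\<in>UNIV. A $ i $ p i) = 0" "(\<Prod>i\<in>UNIV. A0 $ i $ p i) = 0"
      by (auto intro!: prod_zero)
    then show ?thesis by (rule trans[OF _ sym])
  next
    case False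
    then have "p ` range Inl \<subseteq> range Inl"
      by clarsimp (metis obj_sumE rangeI)
    then have *: "p ` range Inl = range Inl"
      using p by (intro endo_inj_surj) (auto intro: permutes_inj_on)
    have "p (Inr b) \<notin> range Inl" for b
      by (subst *[symmetric]) (use permutes_inj[OF p] in \<open>auto dest: injD\<close>)
    then show ?thesis by (intro prod.cong refl) (auto simp: A0_def)
  qed
  then have "det A = det A0" 
    unfolding det_def by (intro sum.cong refl) simp
  also have "A0 = extend_matrix Inl (\<chi> i j. A $ Inl i $ Inl j) **
      extend_matrix Inr (\<chi> i j. A $ Inr i $ Inr j)"
    (is "_ = ?L ** ?R")
  proof -
    have "A0 $ i $ j = (\<Sum>k\<in>UNIV. ?L $ i $ k * ?R $ k $ j)" for i j
    proof -
      have L: "?L $ Inl a $ Inl b = A $ Inl a $ Inl b" "?L $ Inl a $ Inr c = 0"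
        "?L $ Inr c $ k = of_bool (Inr c = k)" for a b c k
        by (auto simp: extend_matrix_def)
      have R: "?R $ Inr c $ Inr d = A $ Inr c $ Inr d" "?R $ Inr c $ Inl a = 0"
        "?R $ Inl a $ k = of_bool (Inl a = k)" for a c d k
        by (auto simp: extend_matrix_def)
      have A0: "A0 $ Inl a $ k = A $ Inl a $ k" "A0 $ Inr c $ Inl a = 0"
        "A0 $ Inr c $ Inr d = A $ Inr c $ Inr d" for a c d k
        by (auto simp: A0_def)
      show ?thesis
        by (cases i; cases j)
          (simp_all add: sum_UNIV_sum_type L R A0 assms of_bool_def mult_delta_left mult_delta_right)
    qed
    then show ?thesis by (simp add: vec_eq_iff matrix_matrix_mult_def)
  qed
  finally show ?thesis by (simp add: det_mul det_extend_matrix)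
qed

section \<open>Regular level sets as oriented manifolds\<close>

definition normal_part :: "real^('a::finite + 'n::finite) \<Rightarrow> real^'a" where
  "normal_part v = (\<chi> a. v $ Inl a)"

definition tangent_part :: "real^('a::finite + 'n::finite) \<Rightarrow> real^'n" where
  "tangent_part v = (\<chi> i. v $ Inr i)"

definition join_parts :: "real^'a \<Rightarrow> real^'n \<Rightarrow> real^('a::finite + 'n::finite)" where
  "join_parts x y = (\<chi> j. case j of Inl a \<Rightarrow> x $ a | Inr i \<Rightarrow> y $ i)"

lemma parts_simps [simp]:
  "normal_part v $ a = v $ Inl a" "tangent_part v $ i = v $ Inr i"
  "join_parts x y $ Inl a = x $ a" "join_parts x y $ Inr i = y $ i"
  "normal_part (join_parts x y) = x" "tangent_part (join_parts x y) = y"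
  "join_parts (normal_part v) (tangent_part v) = v"
  by (auto simp: normal_part_def tangent_part_def join_parts_def vec_eq_iff split: sum.split)

lemma vec_sum_eq_iff: "v = w \<longleftrightarrow> (\<forall>a. v $ Inl a = w $ Inl a) \<and> (\<forall>i. v $ Inr i = w $ Inr i)"
  by (auto simp: vec_eq_iff) (metis sumE)

lemma bounded_linear_parts:
  "bounded_linear normal_part" "bounded_linear tangent_part" "bounded_linear (join_parts 0)"
  by (simp_all add: linear_conv_bounded_linear[symmetric] linear_iff vec_eq_iff join_parts_def
      split: sum.split)

text \<open>The kernel of \<open>D\<close> has dimension \<open>CARD('n)\<close>, so it can be identified with \<open>real^'n\<close>. Extending this
identification to the whole space completes \<open>D\<close> to a linear isomorphism: this provides the linear
coordinates on the level set at a point where \<open>D\<close> is the derivative of the equations.\<close>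
lemma exists_complementary_projection:
  fixes D :: "real^('a::finite + 'n::finite) \<Rightarrow> real^'a"
  assumes "linear D" "surj D"
  obtains P :: "real^('a + 'n) \<Rightarrow> real^'n"
    where "linear P" "det (matrix (\<lambda>v. join_parts (D v) (P v))) > 0"
proof -
  interpret D: linear D by fact
  define K where "K = {v. D v = 0}"
  have subK: "subspace K" using assms(1) unfolding K_def by (rule linear_subspace_kernel)
  obtain s where s: "linear s" "D \<circ> s = id"
    using linear_surjective_right_inverse[OF assms] by blast
  then have Ds: "D (s x) = x" for x by (simp add: pointfree_idE)
  have "inj s" using Ds by (metis injI)
  have "dim (range s) = CARD('a)"
    using dim_image_eq[OF \<open>linear s\<close>, of UNIV] \<open>inj s\<close> by simp
  moreover have "{x + y |x y. x \<in> K \<and> y \<in> range s} = UNIV"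
  proof -
    have "v = (v - s (D v)) + s (D v)" "v - s (D v) \<in> K" for v
      by (auto simp: K_def D.diff Ds)
    then show ?thesis by blast
  qed
  moreover have "K \<inter> range s = {0}"
    using linear_0[OF \<open>linear s\<close>] Ds by (auto simp: K_def image_iff)
  moreover have "subspace (range s)"
    using linear_subspace_image[OF \<open>linear s\<close>] by simp
  ultimately have "dim K = dim (UNIV :: (real^'n) set)"
    using dim_sums_Int[OF subK, of "range s"] by simp
  then obtain f :: "real^('a + 'n) \<Rightarrow> real^'n" where f: "linear f" "\<And>x. x \<in> K \<Longrightarrow> norm (f x) = norm x"
    by (rule isometries_subspaces[OF subK subspace_UNIV]) blast
  have join_linear: "linear (\<lambda>v. join_parts (D v) (P v))" if "linear P" for P :: "_ \<Rightarrow> real^'n"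
    using that by (auto simp: linear_iff vec_sum_eq_iff D.add D.scale)
  have "inj (\<lambda>v. join_parts (D v) (f v))"
    unfolding linear_injective_0[OF join_linear[OF f(1)]]
  proof (intro allI impI)
    fix v assume *: "join_parts (D v) (f v) = 0"
    then have "D v = 0" "f v = 0" by (auto simp: vec_sum_eq_iff vec_eq_iff)
    then show "v = 0" using f(2)[of v] by (simp add: K_def)
  qed
  then have nz: "det (matrix (\<lambda>v. join_parts (D v) (f v))) \<noteq> 0"
    using det_nz_iff_inj[OF join_linear[OF f(1)]] by simp
  show ?thesis
  proof (cases "det (matrix (\<lambda>v. join_parts (D v) (f v))) > 0")
    case True
    then show ?thesis using that f(1) by blast
  next
    case False
    \<comment> \<open>Reflecting one coordinate of the complementary projection reverses the sign.\<close>
    obtain i0 :: 'n where True by blast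
    define r where "r j = (if j = Inr i0 then - 1 else (1::real))" for j :: "'a + 'n"
    define R where "R = (\<chi> i j. if i = j then r i else 0)"
    define P where "P v = (\<chi> i. r (Inr i) * f v $ i)" for v
    have "linear P" using f(1) by (auto simp: P_def linear_iff vec_eq_iff algebra_simps)
    have "det R = (\<Prod>j\<in>UNIV. r j)" by (subst det_diagonal) (auto simp: R_def)
    also have "\<dots> = - 1" by (simp add: r_def prod.delta)
    finally have R: "det R = - 1" .
    have "matrix (\<lambda>v. join_parts (D v) (P v)) = R ** matrix (\<lambda>v. join_parts (D v) (f v))"
      by (auto simp: vec_sum_eq_iff matrix_def matrix_matrix_mult_def R_def P_def r_def mult_delta_left)
    then have "det (matrix (\<lambda>v. join_parts (D v) (P v))) > 0"
      using False nz by (simp add: det_mul R)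
    then show ?thesis using that \<open>linear P\<close> by blast
  qed
qed


text \<open>The points of the manifold are the images of the points of the level set under an injection \<open>e\<close> into
an arbitrary type, which carries no structure of its own: topology and charts are transported along \<open>e\<close>.
The equations only need to make sense on an open domain, so that different systems of equations
can be used on disjoint open sets.\<close>
locale regular_level_set =
  fixes \<Phi> :: "real^('a::finite + 'n::finite) \<Rightarrow> real^'a"
    and \<Omega> :: "(real^('a + 'n)) set"
    and e :: "real^('a + 'n) \<Rightarrow> 'p"
  assumes open_domain: "open \<Omega>" and smooth: "smooth_on \<Omega> \<Phi>"
    and inj: "inj e" and compact_level: "compact {q \<in> \<Omega>. \<Phi> q = 0}"
    and regular: "\<And>q. q \<in> \<Omega> \<Longrightarrow> \<Phi> q = 0 \<Longrightarrow> surj (frechet_derivative \<Phi> (at q))"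
begin

definition N where "N = {q \<in> \<Omega>. \<Phi> q = 0}"

abbreviation \<epsilon> where "\<epsilon> \<equiv> inv_into UNIV e"

definition X where "X = pullback_topology (e ` N) \<epsilon> (top_of_set N)"

text \<open>Local coordinates of the ambient space that extend the values of the equations and are compatible
with the orientation of the ambient space. The remaining coordinates are a chart of the level set, and
the charts obtained in this way are coherently oriented because all flattenings share the normal
coordinates and their orientation.\<close>
definition flattening :: "(real^('a + 'n)) set \<Rightarrow> (real^('a + 'n) \<Rightarrow> real^('a + 'n)) \<Rightarrow> bool" where
  "flattening U H \<longleftrightarrow> open U \<and> U \<subseteq> \<Omega> \<and> smooth_on U H \<and> inj_on H U \<and> open (H ` U) \<and>
     smooth_on (H ` U) (inv_into U H) \<and>
     (\<forall>q\<in>U. jacobian_det H q > 0 \<and> normal_part (H q) = \<Phi> q)"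

definition chart :: "(real^('a + 'n)) set \<Rightarrow> (real^('a + 'n) \<Rightarrow> real^('a + 'n)) \<Rightarrow> ('p, 'n) chart" where
  "chart U H = (e ` (N \<inter> U), \<lambda>p. tangent_part (H (\<epsilon> p)))"

definition atlas :: "('p, 'n) chart set" where
  "atlas = {chart U H |U H. flattening U H}"

lemma \<epsilon>_e [simp]: "\<epsilon> (e q) = q"
  by (simp add: inj)

lemma topspace_X: "topspace X = e ` N"
  by (auto simp: X_def topspace_pullback_topology)

lemma homeomorphic_maps_e: "homeomorphic_maps (top_of_set N) X e \<epsilon>"
  unfolding homeomorphic_maps_def
proof (intro conjI ballI)
  have "\<epsilon> \<circ> e = id" by (simp add: fun_eq_iff)
  then show "continuous_map (top_of_set N) X e"
    unfolding X_def by (intro continuous_map_pullback') auto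
  have "continuous_map (pullback_topology (e ` N) \<epsilon> (top_of_set N)) (top_of_set N) (id \<circ> \<epsilon>)"
    by (rule continuous_map_pullback) simp
  then show "continuous_map X (top_of_set N) \<epsilon>" by (simp add: X_def)
qed (auto simp: topspace_X)

lemma homeomorphic_space_X: "top_of_set N homeomorphic_space X"
  using homeomorphic_maps_e homeomorphic_space_def by blast

lemma X_space_properties: "Hausdorff_space X" "second_countable X" "compact_space X"
proof -
  show "Hausdorff_space X"
    using homeomorphic_Hausdorff_space[OF homeomorphic_space_X]
    by (simp add: Hausdorff_space_subtopology)
  obtain B :: "(real^('a + 'n)) set set" where "countable B" "topological_basis B"
    using ex_countable_basis by blast
  then have "second_countable (euclidean :: (real^('a + 'n)) topology)"
    unfolding second_countable_def
    by (intro exI[of _ B]) (auto simp: topological_basis_open elim!: topological_basisE)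
  then show "second_countable X"
    using homeomorphic_space_second_countability[OF homeomorphic_space_X]
      second_countable_subtopology by blast
  show "compact_space X"
    using homeomorphic_compact_space[OF homeomorphic_space_X] compact_level
    by (simp add: N_def compact_space_subtopology)
qed

lemma flattening_exists:
  assumes "p \<in> N"
  obtains U H where "flattening U H" "p \<in> U"
proof -
  have p: "p \<in> \<Omega>" "\<Phi> p = 0" using assms by (auto simp: N_def)
  have Ck: "Ck_on k \<Omega> \<Phi>" for k using smooth by (simp add: smooth_on_def)
  have D: "(\<Phi> has_derivative frechet_derivative \<Phi> (at p)) (at p)"
    using Ck_on_SucD(1)[OF Ck p(1)] .
  obtain P :: "real^('a + 'n) \<Rightarrow> real^'n" where P: "linear P"
    "det (matrix (\<lambda>v. join_parts (frechet_derivative \<Phi> (at p) v) (P v))) > 0"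
    using exists_complementary_projection[OF has_derivative_linear[OF D] regular[OF p]] by blast
  define H where "H q = join_parts (\<Phi> q) (P q)" for q
  have bP: "bounded_linear P" using P(1) by (simp add: linear_conv_bounded_linear)
  have "Ck_on k \<Omega> (\<lambda>q. H q $ j)" for k j
  proof (cases j)
    case (Inl a)
    then show ?thesis
      using Ck_on_linear_comp[OF bounded_linear_vec_nth open_domain Ck] by (simp add: H_def)
  next
    case (Inr i)
    then show ?thesis
      using Ck_on_linear_comp[OF bounded_linear_vec_nth open_domain Ck_on_bounded_linear[OF bP]]
      by (simp add: H_def)
  qed
  then have sH: "smooth_on \<Omega> H" unfolding smooth_on_def using Ck_on_vec[OF open_domain] by blast
  have dH: "(H has_derivative (\<lambda>v. join_parts (frechet_derivative \<Phi> (at p) v) (P v))) (at p)"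
    unfolding has_derivative_componentwise_within[of H]
  proof
    fix b :: "real^('a + 'n)" assume "b \<in> Basis"
    then obtain j where b: "b = axis j 1" by (auto simp: Basis_vec_def)
    show "((\<lambda>x. H x \<bullet> b) has_derivative
        (\<lambda>v. join_parts (frechet_derivative \<Phi> (at p) v) (P v) \<bullet> b)) (at p)"
    proof (cases j)
      case (Inl a)
      show ?thesis
        using bounded_linear.has_derivative[OF bounded_linear_vec_nth D, of a]
        by (simp add: b H_def Inl inner_axis)
    next
      case (Inr i)
      show ?thesis
        using bounded_linear.has_derivative[OF bounded_linear_vec_nth
          bounded_linear_imp_has_derivative[OF bP], of i]
        by (simp add: b H_def Inr inner_axis)
    qed
  qed
  then have "jacobian_det H p > 0"
    using P(2) by (simp add: jacobian_det_def flip: frechet_derivative_at[OF dH])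
  then obtain U where "open U" "p \<in> U" "U \<subseteq> \<Omega>" "inj_on H U" "open (H ` U)"
    "smooth_on (H ` U) (inv_into U H)" "\<And>q. q \<in> U \<Longrightarrow> jacobian_det H q > 0"
    using local_diffeomorphism[OF open_domain sH p(1)] by blast
  moreover from this have "smooth_on U H"
    using sH Ck_on_subset unfolding smooth_on_def by blast
  ultimately show ?thesis using that[of U H] by (auto simp: flattening_def H_def)
qed

lemma chart_image:
  assumes "flattening U H"
  shows "snd (chart U H) ` fst (chart U H) = {x. join_parts 0 x \<in> H ` U}"
proof -
  have 1: "join_parts 0 (tangent_part (H q)) = H q" if "q \<in> N \<inter> U" for q
    using assms that by (auto simp: flattening_def N_def vec_sum_eq_iff vec_eq_iff)
  have 2: "q \<in> N" if "q \<in> U" "H q = join_parts 0 x" for q x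
    using assms that unfolding flattening_def N_def by (metis (mono_tags) mem_Collect_eq parts_simps(5) subsetD)
  have "x \<in> (\<lambda>q. tangent_part (H q)) ` (N \<inter> U) \<longleftrightarrow> join_parts 0 x \<in> H ` U" for x
  proof
    assume "x \<in> (\<lambda>q. tangent_part (H q)) ` (N \<inter> U)"
    then show "join_parts 0 x \<in> H ` U" using 1 by auto
  next
    assume "join_parts 0 x \<in> H ` U"
    then obtain q where q: "q \<in> U" "H q = join_parts 0 x" by auto
    then have "x = tangent_part (H q)" "q \<in> N \<inter> U" using 2 by auto
    then show "x \<in> (\<lambda>q. tangent_part (H q)) ` (N \<inter> U)" by blast
  qed
  then show ?thesis by (auto simp: chart_def image_image)
qed

lemma chart_inverse:
  assumes "flattening U H" "join_parts 0 x \<in> H ` U"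
  shows "inv_into (e ` (N \<inter> U)) (\<lambda>p. tangent_part (H (\<epsilon> p))) x = e (inv_into U H (join_parts 0 x))"
    and "inv_into U H (join_parts 0 x) \<in> N \<inter> U"
proof -
  obtain q where q: "q \<in> U" "H q = join_parts 0 x" using assms(2) by auto
  then have "q \<in> N"
    using assms unfolding flattening_def N_def by (metis (mono_tags) mem_Collect_eq parts_simps(5) subsetD)
  have inj: "inj_on H U" using assms by (simp add: flattening_def)
  then have qi: "inv_into U H (join_parts 0 x) = q" using q by (metis inv_into_f_f)
  have "inj_on (\<lambda>p. tangent_part (H (\<epsilon> p))) (e ` (N \<inter> U))"
  proof (rule inj_onI)
    fix p p' assume "p \<in> e ` (N \<inter> U)" "p' \<in> e ` (N \<inter> U)"
      and eq: "tangent_part (H (\<epsilon> p)) = tangent_part (H (\<epsilon> p'))"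
    then obtain a b where ab: "a \<in> N \<inter> U" "b \<in> N \<inter> U" "p = e a" "p' = e b" by blast
    then have "normal_part (H a) = normal_part (H b)"
      using assms by (auto simp: flattening_def N_def)
    then have "H a = H b" using eq ab by (metis \<epsilon>_e parts_simps(7))
    then show "p = p'" using inj ab by (auto dest: inj_onD)
  qed
  moreover have "tangent_part (H (\<epsilon> (e q))) = x" using q by simp
  ultimately show "inv_into (e ` (N \<inter> U)) (\<lambda>p. tangent_part (H (\<epsilon> p))) x = e (inv_into U H (join_parts 0 x))"
    using inv_into_f_f[of "\<lambda>p. tangent_part (H (\<epsilon> p))" "e ` (N \<inter> U)" "e q"] \<open>q \<in> N\<close> q qi by auto
  show "inv_into U H (join_parts 0 x) \<in> N \<inter> U" using qi q \<open>q \<in> N\<close> by simp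
qed

lemma chart_on_chart:
  assumes "flattening U H"
  shows "chart_on X (chart U H)"
proof -
  let ?f = "\<lambda>p. tangent_part (H (\<epsilon> p))" and ?g = "\<lambda>x. e (inv_into U H (join_parts 0 x))"
  define V where "V = {x. join_parts 0 x \<in> H ` U}"
  have img: "?f ` e ` (N \<inter> U) = V" using chart_image[OF assms] by (simp add: chart_def V_def)
  have U: "open U" "inj_on H U" "open (H ` U)" using assms by (auto simp: flattening_def)
  have cH: "continuous_on U H" "continuous_on (H ` U) (inv_into U H)"
    using assms unfolding flattening_def smooth_on_def by (metis Ck_on.simps(1))+
  have "open V"
    unfolding V_def using open_vimage[OF U(3) linear_continuous_on[OF bounded_linear_parts(3)]]
    by (simp add: vimage_def)
  have ope: "openin X (e ` (N \<inter> U))"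
    unfolding X_def openin_pullback_topology
    by (rule exI[of _ "N \<inter> U"]) (use U in \<open>auto simp: openin_open\<close>)
  have f: "continuous_map (subtopology X (e ` (N \<inter> U))) (top_of_set V) ?f"
  proof -
    have "continuous_map (subtopology X (e ` (N \<inter> U))) (top_of_set (N \<inter> U)) \<epsilon>"
      using homeomorphic_maps_e
      by (auto simp: homeomorphic_maps_def continuous_map_in_subtopology
          intro: continuous_map_from_subtopology)
    moreover have "continuous_map (top_of_set (N \<inter> U)) (top_of_set V) (\<lambda>q. tangent_part (H q))"
      using img bounded_linear.continuous_on[OF bounded_linear_parts(2) continuous_on_subset[OF cH(1)],
          of "N \<inter> U"]
      by (auto simp: image_image)
    ultimately show ?thesis using continuous_map_compose unfolding o_def by blast
  qed
  have g: "continuous_map (top_of_set V) (subtopology X (e ` (N \<inter> U))) ?g"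
  proof -
    have "continuous_map (top_of_set V) (top_of_set (N \<inter> U)) (\<lambda>x. inv_into U H (join_parts 0 x))"
      using chart_inverse(2)[OF assms]
      by (auto simp: V_def intro!: continuous_on_compose2[OF cH(2)] linear_continuous_on[OF bounded_linear_parts(3)])
    moreover have "continuous_map (top_of_set (N \<inter> U)) (subtopology X (e ` (N \<inter> U))) e"
    proof -
      have "continuous_map (top_of_set N) X e" using homeomorphic_maps_e by (simp add: homeomorphic_maps_def)
      then have "continuous_map (subtopology (top_of_set N) U) X e"
        by (rule continuous_map_from_subtopology)
      then show ?thesis by (auto simp: continuous_map_in_subtopology subtopology_subtopology)
    qed
    ultimately show ?thesis using continuous_map_compose unfolding o_def by blast
  qed
  have "homeomorphic_maps (subtopology X (e ` (N \<inter> U))) (top_of_set V) ?f ?g"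
    unfolding homeomorphic_maps_def
  proof (intro conjI f g ballI)
    fix p assume "p \<in> topspace (subtopology X (e ` (N \<inter> U)))"
    then obtain q where q: "p = e q" "q \<in> N \<inter> U" by (auto simp: topspace_X)
    then have "join_parts 0 (tangent_part (H q)) = H q"
      using assms by (auto simp: flattening_def N_def vec_sum_eq_iff vec_eq_iff)
    then show "?g (?f p) = p" using q U(2) by simp
  next
    fix x assume "x \<in> topspace (top_of_set V)"
    then have "join_parts 0 x \<in> H ` U" by (simp add: V_def)
    then show "?f (?g x) = x" by (simp add: f_inv_into_f)
  qed
  then show ?thesis
    using ope \<open>open V\<close> homeomorphic_map_maps unfolding chart_on_def chart_def split img by blast
qed

lemma atlas_covers: "(\<Union>c\<in>atlas. fst c) = topspace X"
proof
  show "topspace X \<subseteq> (\<Union>c\<in>atlas. fst c)"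
  proof
    fix p assume "p \<in> topspace X"
    then obtain q where q: "q \<in> N" "p = e q" by (auto simp: topspace_X)
    then obtain U H where "flattening U H" "q \<in> U" using flattening_exists by blast
    then have "chart U H \<in> atlas" "p \<in> fst (chart U H)"
      using q by (auto simp: atlas_def chart_def)
    then show "p \<in> (\<Union>c\<in>atlas. fst c)" by blast
  qed
qed (auto simp: atlas_def chart_def topspace_X)

text \<open>The maps of the ambient space that act on the level set smoothly and preserving its orientation. The
linear map \<open>L\<close> describes what happens in the normal directions: orientation is preserved along the level set if the
ambient map and its normal part both preserve or both reverse orientation.\<close>
definition compatible :: "(real^('a + 'n) \<Rightarrow> real^('a + 'n)) \<Rightarrow> bool" where
  "compatible G \<longleftrightarrow> smooth_on \<Omega> G \<and> G ` N \<subseteq> N \<and>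
     (\<forall>q\<in>N. \<exists>W L. open W \<and> q \<in> W \<and> linear L \<and> (\<forall>r\<in>W. \<Phi> (G r) = L (\<Phi> r)) \<and>
        jacobian_det G q * det (matrix L) > 0)"

lemma flattening_join:
  "flattening U H \<Longrightarrow> q \<in> N \<Longrightarrow> q \<in> U \<Longrightarrow> join_parts 0 (tangent_part (H q)) = H q"
  by (auto simp: flattening_def N_def vec_sum_eq_iff vec_eq_iff)

lemma smooth_has_derivative:
  assumes "smooth_on S f" "x \<in> S"
  shows "(f has_derivative frechet_derivative f (at x)) (at x)"
proof -
  have "Ck_on (Suc 0) S f" using assms(1) unfolding smooth_on_def ..
  then show ?thesis using Ck_on_SucD(1) assms(2) by blast
qed

text \<open>In flattening coordinates a compatible map transforms the normal coordinates near each point of the level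
  set by a linear map that does not involve the tangential coordinates, so that its Jacobian matrix is block triangular with the local
  representation in the second diagonal block.\<close>

lemma
  assumes UH: "flattening U H" and UH': "flattening U' H'"
    and G: "compatible G" and F: "\<And>q. q \<in> N \<Longrightarrow> F (e q) = e (G q)"
  defines "D \<equiv> local_dom (chart U H) F (chart U' H')"
    and "R \<equiv> local_rep (chart U H) F (chart U' H')"
  shows smooth_on_local_rep: "smooth_on D R"
    and jacobian_det_local_rep: "x \<in> D \<Longrightarrow> jacobian_det R x > 0"
proof -
  let ?K = "inv_into U H"
  let ?T = "\<lambda>y. H' (G (?K y))"
  let ?R = "\<lambda>x. tangent_part (?T (join_parts 0 x))"
  define P where "P = {y \<in> H ` U. G (?K y) \<in> U'}"
  have U: "open U" "U \<subseteq> \<Omega>" "inj_on H U" "open (H ` U)" "smooth_on U H" "smooth_on (H ` U) ?K"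
    "\<And>q. q \<in> U \<Longrightarrow> jacobian_det H q > 0" "\<And>q. q \<in> U \<Longrightarrow> normal_part (H q) = \<Phi> q"
    using UH by (auto simp: flattening_def)
  have U': "open U'" "smooth_on U' H'"
    "\<And>q. q \<in> U' \<Longrightarrow> jacobian_det H' q > 0" "\<And>q. q \<in> U' \<Longrightarrow> normal_part (H' q) = \<Phi> q"
    using UH' by (auto simp: flattening_def)
  have sG: "smooth_on \<Omega> G" and GN: "\<And>q. q \<in> N \<Longrightarrow> G q \<in> N"
    using G by (auto simp: compatible_def)
  have KU: "?K y \<in> U" "H (?K y) = y" if "y \<in> H ` U" for y
    using that by (auto intro: inv_into_into f_inv_into_f)
  have Ck_GK: "Ck_on k (H ` U) (\<lambda>y. G (?K y))" for k
  proof (rule Ck_on_compose[OF U(4) open_domain, where f = ?K and g = G])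
    show "?K ` H ` U \<subseteq> \<Omega>" using KU(1) U(2) by blast
  qed (use U(6) sG in \<open>simp_all add: smooth_on_def\<close>)
  have "open P"
    using continuous_open_preimage[OF _ U(4) U'(1)] Ck_GK[of 0] by (simp add: P_def vimage_def Int_def)
  have Ck_T: "Ck_on k P ?T" for k
  proof (rule Ck_on_compose[OF \<open>open P\<close> U'(1), where f = "\<lambda>y. G (?K y)" and g = H'])
    show "Ck_on k U' H'" using U'(2) by (simp add: smooth_on_def)
    show "Ck_on k P (\<lambda>y. G (?K y))" by (rule Ck_on_subset[OF Ck_GK]) (auto simp: P_def)
  qed (auto simp: P_def)
  have D: "D = {x. join_parts 0 x \<in> P}"
  proof (intro subset_antisym subsetI)
    fix x assume "x \<in> D"
    then obtain q where q: "q \<in> N" "q \<in> U" "x = tangent_part (H q)" "F (e q) \<in> e ` (N \<inter> U')"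
      by (auto simp: D_def local_dom_def chart_def)
    then have "G q \<in> U'" using F[OF q(1)] inj by (auto dest: injD)
    then show "x \<in> {x. join_parts 0 x \<in> P}"
      using q flattening_join[OF UH q(1,2)] U(3) by (simp add: P_def)
  next
    fix x assume "x \<in> {x. join_parts 0 x \<in> P}"
    then have x: "join_parts 0 x \<in> H ` U" "G (?K (join_parts 0 x)) \<in> U'" by (auto simp: P_def)
    let ?q = "?K (join_parts 0 x)"
    have q: "?q \<in> N" "?q \<in> U" using chart_inverse(2)[OF UH x(1)] by auto
    have "tangent_part (H (\<epsilon> (e ?q))) = x" unfolding \<epsilon>_e KU(2)[OF x(1)] by (rule parts_simps)
    moreover have "e ?q \<in> {p \<in> e ` (N \<inter> U). F p \<in> e ` (N \<inter> U')}"
      using q x(2) GN[OF q(1)] F[OF q(1)] by simp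
    from this have "tangent_part (H (\<epsilon> (e ?q))) \<in> D"
      unfolding D_def local_dom_def chart_def prod.case by (rule imageI)
    ultimately show "x \<in> D" by (rule subst)
  qed
  have R: "R x = ?R x" if "x \<in> D" for x
  proof -
    have x: "join_parts 0 x \<in> H ` U" using that by (simp add: D P_def)
    have "?K (join_parts 0 x) \<in> N" using chart_inverse(2)[OF UH x] by simp
    then show ?thesis
      by (simp add: R_def local_rep_def chart_def chart_inverse(1)[OF UH x] F)
  qed
  have "open D"
    using open_vimage[OF \<open>open P\<close> linear_continuous_on[OF bounded_linear_parts(3)]]
    by (simp add: D vimage_def)
  have "Ck_on k D ?R" for k
    by (intro Ck_on_linear_comp[OF bounded_linear_parts(2) \<open>open D\<close>]
        Ck_on_compose[OF \<open>open D\<close> \<open>open P\<close> _ Ck_T, where f = "join_parts 0"]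
        Ck_on_bounded_linear bounded_linear_parts)
      (auto simp: D)
  then show "smooth_on D R"
    unfolding smooth_on_def using Ck_on_cong[OF \<open>open D\<close>, of ?R R] R by metis

  assume "x \<in> D"
  let ?y = "join_parts 0 x"
  let ?q = "?K ?y"
  have y: "?y \<in> P" "?y \<in> H ` U" "?q \<in> U" "G ?q \<in> U'" "H ?q = ?y"
    using \<open>x \<in> D\<close> KU by (auto simp: D P_def)
  have qN: "?q \<in> N" using chart_inverse(2)[OF UH y(2)] by simp
  define dK where "dK = frechet_derivative ?K (at ?y)"
  define dG where "dG = frechet_derivative G (at ?q)"
  define dH where "dH = frechet_derivative H (at ?q)"
  define dH' where "dH' = frechet_derivative H' (at (G ?q))"
  have dK: "(?K has_derivative dK) (at ?y)"
    unfolding dK_def using smooth_has_derivative[OF U(6) y(2)] .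
  have dG: "(G has_derivative dG) (at ?q)"
    unfolding dG_def using smooth_has_derivative[OF sG] y(3) U(2) by blast
  have dH: "(H has_derivative dH) (at ?q)"
    unfolding dH_def using smooth_has_derivative[OF U(5) y(3)] .
  have dH': "(H' has_derivative dH') (at (G ?q))"
    unfolding dH'_def using smooth_has_derivative[OF U'(2) y(4)] .
  note lin = dK[THEN has_derivative_linear] dG[THEN has_derivative_linear]
    dH[THEN has_derivative_linear] dH'[THEN has_derivative_linear]
  define dT where "dT = dH' \<circ> (dG \<circ> dK)"
  have dT: "(?T has_derivative dT) (at ?y)"
    unfolding dT_def o_def
    by (rule has_derivative_compose[OF has_derivative_compose[OF dK dG] dH'])
  have "((\<lambda>y. H (?K y)) has_derivative (\<lambda>v. dH (dK v))) (at ?y)"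
    by (rule has_derivative_compose[OF dK dH])
  moreover have "((\<lambda>y. H (?K y)) has_derivative id) (at ?y)"
    by (rule has_derivative_transform_within_open[OF has_derivative_id U(4) y(2)]) (simp add: KU)
  ultimately have "dH \<circ> dK = id" using has_derivative_unique unfolding o_def by blast
  then have "det (matrix dH) * det (matrix dK) = 1"
    using matrix_compose[OF lin(1) lin(3)] matrix_id by (metis det_mul)
  moreover have "det (matrix dH) > 0" using U(7)[OF y(3)] by (simp add: jacobian_det_def dH_def)
  ultimately have K_pos: "det (matrix dK) > 0" by (metis zero_less_mult_pos zero_less_one)
  have H'_pos: "det (matrix dH') > 0" using U'(3)[OF y(4)] by (simp add: jacobian_det_def dH'_def)
  from G have "\<forall>q\<in>N. \<exists>W L. open W \<and> q \<in> W \<and> linear L \<and> (\<forall>r\<in>W. \<Phi> (G r) = L (\<Phi> r)) \<and>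
      jacobian_det G q * det (matrix L) > 0"
    unfolding compatible_def by (elim conjE)
  from bspec[OF this qN] obtain W L where "open W" "?q \<in> W" "linear L"
    "\<forall>r\<in>W. \<Phi> (G r) = L (\<Phi> r)" "jacobian_det G ?q * det (matrix L) > 0"
    by (elim exE conjE)
  then have W: "open W" "?q \<in> W" "linear L" "\<And>r. r \<in> W \<Longrightarrow> \<Phi> (G r) = L (\<Phi> r)"
    and sign: "det (matrix dG) * det (matrix L) > 0"
    by (auto simp: jacobian_det_def dG_def)
  have "bounded_linear L" using W(3) by (simp add: linear_conv_bounded_linear)
  define P' where "P' = {y \<in> H ` U. ?K y \<in> W} \<inter> P"
  have "continuous_on (H ` U) ?K" using U(6) unfolding smooth_on_def by (metis Ck_on.simps(1))
  then have "open P'"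
    using open_Int[OF continuous_open_preimage[OF _ U(4) W(1)] \<open>open P\<close>]
    by (simp add: P'_def vimage_def Int_def)
  \<comment> \<open>Differentiating the normal part of the coordinate expression in two ways shows that the rows of normal indices contain \<open>L\<close> and zeros.\<close>
  have "((\<lambda>y. normal_part (?T y)) has_derivative (\<lambda>v. L (normal_part v))) (at ?y)"
  proof (rule has_derivative_transform_within_open[OF _ \<open>open P'\<close>])
    show "((\<lambda>y. L (normal_part y)) has_derivative (\<lambda>v. L (normal_part v))) (at ?y)"
      by (intro bounded_linear.has_derivative[OF \<open>bounded_linear L\<close>]
          bounded_linear_imp_has_derivative bounded_linear_parts)
    show "?y \<in> P'" using y W(2) by (simp add: P'_def)
    fix z assume "z \<in> P'"
    then show "L (normal_part z) = normal_part (?T z)"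
      using KU[of z] U(8)[of "?K z"] U'(4)[of "G (?K z)"] W(4)[of "?K z"] by (auto simp: P'_def P_def)
  qed
  moreover have "((\<lambda>y. normal_part (?T y)) has_derivative (\<lambda>v. normal_part (dT v))) (at ?y)"
    by (rule bounded_linear.has_derivative[OF bounded_linear_parts(1) dT])
  ultimately have "(\<lambda>v. normal_part (dT v)) = (\<lambda>v. L (normal_part v))"
    by (rule has_derivative_unique[symmetric])
  then have normal: "dT v $ Inl a = L (normal_part v) $ a" for v a
    by (metis parts_simps(1))
  have axes: "normal_part (axis (Inr b) 1 :: real^('a + 'n)) = 0"
    "normal_part (axis (Inl a) 1 :: real^('a + 'n)) = axis a 1"
    "join_parts 0 (axis b 1) = (axis (Inr b) 1 :: real^('a + 'n))" for a b
    by (auto simp: axis_def vec_eq_iff join_parts_def split: sum.split)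
  define J where "J = (\<chi> i j. matrix dT $ Inr i $ Inr j)"
  have "det (matrix dT) = det (\<chi> i j. matrix dT $ Inl i $ Inl j) * det J"
    unfolding J_def
    by (rule det_block_triangular) (simp add: matrix_def normal axes linear_0[OF W(3)])
  also have "(\<chi> i j. matrix dT $ Inl i $ Inl j) = matrix L"
    by (simp add: matrix_def normal axes)
  also have "matrix dT = matrix dH' ** (matrix dG ** matrix dK)"
    unfolding dT_def using lin by (metis matrix_compose linear_compose)
  finally have "det (matrix dH') * det (matrix dG) * det (matrix dK) = det (matrix L) * det J"
    by (simp add: det_mul)
  \<comment> \<open>The sign of \<open>det J\<close> is read off after multiplying by the positive square of \<open>det L\<close>.\<close>
  then have "(det (matrix L) * det (matrix L)) * det J =
      (det (matrix dH') * det (matrix dK)) * (det (matrix dG) * det (matrix L))"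
    by (simp add: algebra_simps)
  also have "\<dots> > 0" using H'_pos K_pos sign by simp
  finally have "det J > 0"
    by (metis not_less zero_le_square mult_nonneg_nonpos)
  moreover have "jacobian_det R x = det J"
  proof -
    have "(?R has_derivative (\<lambda>v. tangent_part (dT (join_parts 0 v)))) (at x)"
      by (rule bounded_linear.has_derivative[OF bounded_linear_parts(2)
          has_derivative_compose[OF bounded_linear_imp_has_derivative[OF bounded_linear_parts(3)] dT]])
    then have "(R has_derivative (\<lambda>v. tangent_part (dT (join_parts 0 v)))) (at x)"
      by (rule has_derivative_transform_within_open[OF _ \<open>open D\<close> \<open>x \<in> D\<close>]) (simp add: R)
    from frechet_derivative_at[OF this, symmetric] show ?thesis by (simp add: jacobian_det_def J_def matrix_def axes)
  qed
  ultimately show "jacobian_det R x > 0" by simp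
qed

lemma compatible_id: "compatible id"
proof -
  have "smooth_on \<Omega> id"
    by (auto simp: smooth_on_def id_def intro!: Ck_on_bounded_linear bounded_linear_ident)
  moreover have "jacobian_det id q * det (matrix (id :: real^'a \<Rightarrow> real^'a)) > 0" for q :: "real^('a + 'n)"
    by (simp add: jacobian_det_def matrix_id frechet_derivative_id)
  ultimately show ?thesis
    unfolding compatible_def using open_domain
    by (auto simp: N_def linear_id intro!: exI[of _ \<Omega>] exI[of _ id])
qed

lemma smooth_atlas_atlas: "smooth_atlas X atlas"
  unfolding smooth_atlas_def
  using chart_on_chart atlas_covers smooth_on_local_rep[OF _ _ compatible_id, of _ _ _ _ id]
  by (auto simp: atlas_def)

lemma closed_smooth_manifold: "closed_smooth_manifold X atlas"
  using X_space_properties smooth_atlas_atlas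
  by (simp add: closed_smooth_manifold_def smooth_manifold_def)

lemma orientation_of_atlas: "orientation_of X atlas atlas"
  unfolding orientation_of_def
  using smooth_atlas_atlas jacobian_det_local_rep[OF _ _ compatible_id, of _ _ _ _ id]
  by (auto simp: atlas_def)

lemma
  assumes G: "compatible G" and F: "\<And>q. q \<in> N \<Longrightarrow> F (e q) = e (G q)"
  shows smooth_self_map_compatible: "smooth_self_map X atlas F"
    and preserves_orientation_compatible: "preserves_orientation atlas F"
proof -
  have GN: "G ` N \<subseteq> N" and "Ck_on 0 \<Omega> G"
    using G unfolding compatible_def smooth_on_def by blast+
  then have "continuous_on N G" by (auto simp: N_def intro: continuous_on_subset)
  then have "continuous_map X X (e \<circ> (G \<circ> \<epsilon>))"
    using homeomorphic_maps_e GN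
    by (intro continuous_map_compose[of _ "top_of_set N"]) (auto simp: homeomorphic_maps_def)
  then have "continuous_map X X F"
    by (rule continuous_map_eq) (auto simp: topspace_X F)
  then show "smooth_self_map X atlas F"
    unfolding smooth_self_map_def using smooth_on_local_rep[OF _ _ G F] by (auto simp: atlas_def)
  show "preserves_orientation atlas F"
    unfolding preserves_orientation_def using jacobian_det_local_rep[OF _ _ G F]
    by (auto simp: atlas_def)
qed

end

section \<open>A complex structure on an even-dimensional coordinate space\<close>

text \<open>The involution \<open>\<sigma>\<close> pairs the coordinates, and \<open>c\<close> is 1 on one member of each pair and \<open>- 1\<close> on the other.
If the member with \<open>c i = 1\<close> is read as a real part and its partner as the corresponding imaginary part, then
\<open>real^'n\<close> becomes \<open>\<complex>\<^sup>r\<close>, and the maps defined below are complex conjugation (\<open>conj_vec\<close>), exchange of real and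
imaginary parts (\<open>swap_vec\<close>), multiplication by \<open>\<i>\<close> (\<open>i_times\<close>) and by a complex number (\<open>cmul\<close>), and the complex
bilinear dot product (\<open>cdot\<close>).\<close>
locale paired_coordinates =
  fixes \<sigma> :: "'n::finite \<Rightarrow> 'n" and c :: "'n \<Rightarrow> real"
  assumes \<sigma>_\<sigma> [simp]: "\<sigma> (\<sigma> i) = i"
    and c_\<sigma> [simp]: "c (\<sigma> i) = - c i"
    and c_c [simp]: "c i * c i = 1"
begin

definition conj_vec :: "real^'n \<Rightarrow> real^'n" where
  "conj_vec z = (\<chi> i. c i * z $ i)"

definition swap_vec :: "real^'n \<Rightarrow> real^'n" where
  "swap_vec z = (\<chi> i. z $ \<sigma> i)"

definition i_times :: "real^'n \<Rightarrow> real^'n" where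
  "i_times z = (\<chi> i. - c i * z $ \<sigma> i)"

definition cmul :: "complex \<Rightarrow> real^'n \<Rightarrow> real^'n" where
  "cmul u z = Re u *\<^sub>R z + Im u *\<^sub>R i_times z"

definition cdot :: "real^'n \<Rightarrow> real^'n \<Rightarrow> complex" where
  "cdot z y = of_real (y \<bullet> conj_vec z) + \<i> * of_real (y \<bullet> swap_vec z)"

lemma c_c' [simp]: "c i * (c i * x) = x"
  using c_c[of i] by (metis mult.assoc mult_1)

lemma sum_\<sigma>: "(\<Sum>i\<in>UNIV. f (\<sigma> i)) = (\<Sum>i\<in>UNIV. f i)"
  by (rule sum.reindex_bij_witness[of _ \<sigma> \<sigma>]) auto

lemma linear_vec_maps: "linear conj_vec" "linear swap_vec" "linear i_times" "linear (cmul u)"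
  by (auto simp: linear_iff conj_vec_def swap_vec_def i_times_def cmul_def vec_eq_iff algebra_simps)

lemma vec_map_relations [simp]:
  "conj_vec (conj_vec z) = z" "swap_vec (swap_vec z) = z" "i_times (i_times z) = - z"
  "conj_vec (i_times z) = - swap_vec z" "swap_vec (i_times z) = conj_vec z"
  "i_times (conj_vec z) = swap_vec z"
  by (auto simp: conj_vec_def swap_vec_def i_times_def vec_eq_iff)

lemma inner_maps:
  "y \<bullet> conj_vec z = conj_vec y \<bullet> z" "y \<bullet> swap_vec z = swap_vec y \<bullet> z"
  "y \<bullet> i_times z = - (i_times y \<bullet> z)"
proof -
  show "y \<bullet> conj_vec z = conj_vec y \<bullet> z"
    by (simp add: inner_vec_def conj_vec_def mult_ac)
  show "y \<bullet> swap_vec z = swap_vec y \<bullet> z"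
    using sum_\<sigma>[of "\<lambda>i. y $ i * z $ \<sigma> i"] by (simp add: inner_vec_def swap_vec_def mult_ac)
  show "y \<bullet> i_times z = - (i_times y \<bullet> z)"
    using sum_\<sigma>[of "\<lambda>i. c i * (y $ i * z $ \<sigma> i)"]
    by (simp add: inner_vec_def i_times_def mult_ac sum_negf)
qed

lemma inner_rels [simp]:
  "conj_vec y \<bullet> conj_vec z = y \<bullet> z" "swap_vec y \<bullet> swap_vec z = y \<bullet> z"
  "i_times y \<bullet> i_times z = y \<bullet> z"
  "z \<bullet> i_times z = 0" "i_times z \<bullet> z = 0"
  "conj_vec z \<bullet> swap_vec z = 0" "swap_vec z \<bullet> conj_vec z = 0"
  "i_times z \<bullet> conj_vec z = - (z \<bullet> swap_vec z)" "i_times z \<bullet> swap_vec z = z \<bullet> conj_vec z"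
proof -
  show "z \<bullet> i_times z = 0" using inner_maps(3)[of z z] by (simp add: inner_commute)
  then show "i_times z \<bullet> z = 0" by (simp add: inner_commute)
  show "conj_vec y \<bullet> conj_vec z = y \<bullet> z" by (simp add: inner_maps(1))
  show "swap_vec y \<bullet> swap_vec z = y \<bullet> z" by (simp add: inner_maps(2))
  show "i_times y \<bullet> i_times z = y \<bullet> z" by (simp add: inner_maps(3))
  have "conj_vec z \<bullet> swap_vec z = i_times (conj_vec z) \<bullet> conj_vec z"
    by (simp add: inner_commute)
  also have "\<dots> = 0" using inner_maps(3)[of "conj_vec z" "conj_vec z"] by (simp add: inner_commute)
  finally show "conj_vec z \<bullet> swap_vec z = 0" .
  then show "swap_vec z \<bullet> conj_vec z = 0" by (simp add: inner_commute)
  show "i_times z \<bullet> conj_vec z = - (z \<bullet> swap_vec z)"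
    using inner_maps(3)[of z "conj_vec z"] by simp
  show "i_times z \<bullet> swap_vec z = z \<bullet> conj_vec z"
    using inner_maps(2)[of "i_times z" z] by (simp add: inner_commute)
qed

lemma cmul_1 [simp]: "cmul 1 z = z"
  by (simp add: cmul_def)

lemma cmul_cmul: "cmul u (cmul v z) = cmul (u * v) z"
  using linear_vec_maps(3) by (simp add: cmul_def linear_add linear_scale algebra_simps)

lemma conj_vec_cmul: "conj_vec (cmul u z) = cmul (cnj u) (conj_vec z)"
  using linear_vec_maps(1) by (simp add: cmul_def linear_add linear_scale)

lemma inner_cmul: "cmul u z \<bullet> cmul u z = (cmod u)\<^sup>2 * (z \<bullet> z)"
  unfolding cmod_power2
  by (simp add: cmul_def inner_add_left inner_add_right power2_eq_square algebra_simps)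

lemma cdot_cmul: "cdot (cmul u z) (cmul u z) = u\<^sup>2 * cdot z z"
  using linear_vec_maps(1,2)
  by (simp add: complex_eq_iff cdot_def cmul_def linear_add linear_scale inner_add_left
      inner_add_right power2_eq_square algebra_simps)

lemma cdot_conj_vec: "cdot (conj_vec z) (conj_vec z) = cnj (cdot z z)"
proof -
  have "conj_vec z \<bullet> swap_vec (conj_vec z) = - (z \<bullet> swap_vec z)"
    using vec_map_relations(5)[of "i_times (conj_vec z)"]
      inner_maps(1)[of z "swap_vec (conj_vec z)"] vec_map_relations(4)[of "conj_vec z"]
    by (metis inner_minus_right vec_map_relations inner_maps(1))
  then show ?thesis by (simp add: complex_eq_iff cdot_def inner_commute)
qed

text \<open>For \<open>z \<noteq> 0\<close> the vectors \<open>conj_vec z\<close> and \<open>swap_vec z\<close> are orthogonal of equal length, and they are the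
gradients of the real and imaginary parts of \<open>cdot z z\<close> up to a factor. In their span the linearised
equation is therefore solved explicitly.\<close>
lemma cdot_frame: "cdot z (a *\<^sub>R conj_vec z + b *\<^sub>R swap_vec z) = of_real (z \<bullet> z) * Complex a b"
  by (simp add: complex_eq_iff cdot_def inner_add_left)

lemma inner_frame: "z \<bullet> (a *\<^sub>R conj_vec z + b *\<^sub>R swap_vec z) = Re (cnj (cdot z z) * Complex a b)"
  by (simp add: cdot_def inner_add_right)

end

lemma exists_paired_coordinates:
  assumes "CARD('n::finite) mod 4 = 2"
  obtains \<sigma> :: "'n::finite \<Rightarrow> 'n" and c where "paired_coordinates \<sigma> c" "(\<Prod>i\<in>UNIV. c i) = - 1"
proof -
  define r where "r = CARD('n) div 2"
  have r: "CARD('n) = 2 * r" "odd r" using assms unfolding r_def by presburger+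
  obtain T :: "'n set" where T: "card T = r"
    using obtain_subset_with_card_n[of r "UNIV :: 'n set"] r by auto
  have cT: "card (- T) = r" using T r by (simp add: Compl_eq_Diff_UNIV card_Diff_subset)
  obtain h where h: "bij_betw h T (- T)"
    using finite_same_card_bij[of T "- T"] T cT by auto
  define \<sigma> where "\<sigma> i = (if i \<in> T then h i else inv_into T h i)" for i
  define c where "c i = (if i \<in> T then 1 else - 1 :: real)" for i
  have hT: "h i \<notin> T" if "i \<in> T" for i using h that by (auto simp: bij_betw_def)
  have hi: "inv_into T h i \<in> T" "h (inv_into T h i) = i" if "i \<notin> T" for i
    using h that by (auto simp: bij_betw_def inv_into_into f_inv_into_f)
  have ih: "inv_into T h (h i) = i" if "i \<in> T" for i
    using h that by (auto simp: bij_betw_def)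
  have "paired_coordinates \<sigma> c"
    by unfold_locales (auto simp: \<sigma>_def c_def hT hi ih)
  moreover have "(\<Prod>i\<in>UNIV. c i) = (\<Prod>i\<in>- T. c i)"
    by (rule prod.mono_neutral_right) (auto simp: c_def)
  then have "(\<Prod>i\<in>UNIV. c i) = - 1"
    using cT r by (simp add: c_def)
  ultimately show ?thesis using that by blast
qed

section \<open>Regularity of the Milnor fibre and its bounding sphere\<close>

context paired_coordinates
begin

text \<open>The derivatives of the complex equation \<open>z \<cdot> z = Y - Y^(k+1)\<close> and of the real equation
\<open>t\<^sup>2 + |z|\<^sup>2 + |Y|\<^sup>2 / 2 = 4\<close> are jointly onto. The first alone is onto, since the Milnor fibre is smooth. It remains to
find a vector in its kernel on which the second does not vanish. At a point where there is none, \<open>t = 0\<close>, then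
\<open>z\<close> is a complex multiple of a real vector, that is \<open>|z \<cdot> z| = |z|\<^sup>2\<close>, and finally either \<open>z = 0\<close> or
\<open>|1 - (k + 1) Y^k| = |Y|\<close>. Both force \<open>|Y| \<le> 1\<close> and hence \<open>|z|\<^sup>2 \<le> 2\<close>. So
\<open>t\<^sup>2 + |z|\<^sup>2 + |Y|\<^sup>2 / 2 \<le> 5/2\<close>, and the level 4 is out of reach.\<close>

lemma equation_surjective:
  fixes t :: real and Y :: complex and z :: "real^'n" and k :: nat
  assumes "k > 0" and eq: "cdot z z = Y - Y ^ (k + 1)"
    and level: "t\<^sup>2 + z \<bullet> z + (cmod Y)\<^sup>2 / 2 = 4"
  shows "\<exists>s \<eta> y. 2 * cdot z y - (1 - of_nat (k + 1) * Y ^ k) * \<eta> = F \<and>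
      2 * t * s + 2 * (z \<bullet> y) + Y \<bullet> \<eta> = h"
proof -
  define d where "d = 1 - of_nat (k + 1) * Y ^ k"
  define A where "A \<eta> y = 2 * cdot z y - d * \<eta>" for \<eta> y
  define B where "B s \<eta> y = 2 * t * s + 2 * (z \<bullet> y) + Y \<bullet> \<eta>" for s \<eta> y
  have A_add: "A (\<eta> + r *\<^sub>R \<eta>') (y + r *\<^sub>R y') = A \<eta> y + r *\<^sub>R A \<eta>' y'" for r \<eta> \<eta>' y y'
    by (simp add: A_def cdot_def inner_add_left complex_eq_iff algebra_simps)
  have B_add: "B (s + r * s') (\<eta> + r *\<^sub>R \<eta>') (y + r *\<^sub>R y') = B s \<eta> y + r * B s' \<eta>' y'" for r s s' \<eta> \<eta>' y y'
    by (simp add: B_def inner_add_right algebra_simps)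
  have eq': "cdot z z = Y * (1 - Y ^ k)" using eq by (simp add: algebra_simps)
  have z0: "Y = 0 \<or> Y ^ k = 1" if "z = 0"
    using eq' that by (simp add: cdot_def)
  have frame: "2 * cdot z ((Re a / (2 * (z \<bullet> z))) *\<^sub>R conj_vec z + (Im a / (2 * (z \<bullet> z))) *\<^sub>R swap_vec z) = a"
    if "z \<noteq> 0" for a
    using that by (simp add: cdot_frame complex_eq_iff)
  have first: "\<exists>\<eta> y. A \<eta> y = F" for F
  proof (cases "z = 0")
    case True
    then have "d \<noteq> 0" using z0 \<open>k > 0\<close> by (auto simp: d_def power_0_left)
    then have "A (- F / d) 0 = F" by (simp add: A_def cdot_def)
    then show ?thesis by blast
  next
    case False
    from frame[OF this, of F] show ?thesis unfolding A_def
      by (metis diff_zero mult_zero_right)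
  qed
  have kernel: "\<exists>s \<eta> y. A \<eta> y = 0 \<and> B s \<eta> y \<noteq> 0"
  proof (cases "t = 0")
    case False
    then have "A 0 0 = 0" "B 1 0 0 \<noteq> 0" by (simp_all add: A_def B_def cdot_def)
    then show ?thesis by blast
  next
    case t: True
    have "z \<noteq> 0"
    proof
      assume "z = 0"
      then have "Y = 0 \<or> cmod Y ^ k = 1" using z0 by (metis norm_one norm_power)
      then have "cmod Y \<le> 1"
        using one_less_power[OF _ \<open>k > 0\<close>, of "cmod Y"] by (cases "cmod Y > 1") auto
      then have "(cmod Y)\<^sup>2 \<le> 1" by (simp add: power_le_one)
      then show False using level t \<open>z = 0\<close> by simp
    qed
    then have zz: "z \<bullet> z > 0" by simp
    show ?thesis
    proof (cases "cmod (cdot z z) = z \<bullet> z")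
      case False
      \<comment> \<open>This is \<open>|z|\<^sup>2\<close> times the part of \<open>z\<close> orthogonal to the gradients of the complex equation.\<close>
      define y where "y = (z \<bullet> z) *\<^sub>R z + (- 1) *\<^sub>R
        (Re (cdot z z) *\<^sub>R conj_vec z + Im (cdot z z) *\<^sub>R swap_vec z)"
      have "A 0 y = 0"
        using A_add[of 0 "- 1" 0 "(z \<bullet> z) *\<^sub>R z"
            "Re (cdot z z) *\<^sub>R conj_vec z + Im (cdot z z) *\<^sub>R swap_vec z"]
        by (simp add: y_def A_def cdot_frame) (simp add: cdot_def algebra_simps)
      moreover have "z \<bullet> y = (z \<bullet> z)\<^sup>2 - (cmod (cdot z z))\<^sup>2"
        unfolding y_def inner_add_right[of z "_ *\<^sub>R z"] inner_scaleR_right[of z "- 1"] inner_frame cmod_power2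
        by (simp add: power2_eq_square)
      moreover have "(z \<bullet> z)\<^sup>2 \<noteq> (cmod (cdot z z))\<^sup>2"
        using False zz by (metis abs_norm_cancel abs_of_pos power2_eq_iff_nonneg norm_ge_zero order_less_imp_le)
      ultimately have "A 0 y = 0 \<and> B 0 0 y \<noteq> 0" by (simp add: B_def)
      then show ?thesis by blast
    next
      case True
      have "cmod Y > 1"
      proof (rule ccontr)
        assume "\<not> cmod Y > 1"
        then have Y: "cmod Y \<le> 1" by simp
        have "cmod (1 - Y ^ k) \<le> 1 + cmod (Y ^ k)" using norm_triangle_ineq4[of 1 "Y ^ k"] by simp
        also have "\<dots> \<le> 2" using Y by (simp add: norm_power power_le_one)
        finally have "z \<bullet> z \<le> 1 * 2"
          unfolding True[symmetric] eq' norm_mult using Y by (intro mult_mono) auto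
        moreover have "(cmod Y)\<^sup>2 \<le> 1" using Y by (simp add: power_le_one)
        ultimately show False using level t by simp
      qed
      have "cmod Y ^ 1 \<le> cmod Y ^ k" using \<open>cmod Y > 1\<close> \<open>k > 0\<close> by (intro power_increasing) auto
      then have "2 * cmod Y \<le> real (k + 1) * cmod Y ^ k"
        using \<open>k > 0\<close> by (intro mult_mono) auto
      moreover have "cmod (of_nat (k + 1) * Y ^ k) \<le> 1 + cmod d"
        using norm_triangle_ineq4[of 1 d] by (simp add: d_def)
      then have "real (k + 1) * cmod Y ^ k \<le> 1 + cmod d"
        unfolding norm_mult norm_of_nat norm_power .
      ultimately have d: "cmod d > cmod Y"
        using \<open>cmod Y > 1\<close> by linarith
      \<comment> \<open>If \<open>y\<close> in the span of the gradients compensates a change \<open>\<eta>\<close> of \<open>Y\<close>, the real equation changes by \<open>Re (m * \<eta>)\<close>.\<close>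
      define m where "m = cnj (cdot z z) * d / of_real (z \<bullet> z) + cnj Y"
      have "m \<noteq> 0"
      proof
        assume "m = 0"
        then have "cmod (cnj (cdot z z) * d / of_real (z \<bullet> z)) = cmod (cnj Y)"
          unfolding m_def by (metis add_eq_0_iff norm_minus_cancel)
        then show False using d True zz by (simp add: norm_mult norm_divide)
      qed
      define a where "a = d * cnj m"
      define y where "y = (Re a / (2 * (z \<bullet> z))) *\<^sub>R conj_vec z + (Im a / (2 * (z \<bullet> z))) *\<^sub>R swap_vec z"
      have "A (cnj m) y = 0" unfolding A_def y_def frame[OF \<open>z \<noteq> 0\<close>] by (simp add: a_def)
      moreover have "B 0 (cnj m) y = Re (m * cnj m)"
      proof -
        have "2 * (z \<bullet> y) = Re (cnj (cdot z z) * a / of_real (z \<bullet> z))"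
          unfolding y_def inner_frame using zz by (simp add: field_simps)
        moreover have "Y \<bullet> cnj m = Re (cnj Y * cnj m)" by (simp add: inner_complex_def)
        moreover have "m * x = cnj (cdot z z) * (d * x) / of_real (z \<bullet> z) + cnj Y * x" for x
          by (simp add: m_def algebra_simps)
        ultimately show ?thesis by (simp only: B_def a_def plus_complex.simps)
      qed
      moreover have "Re (m * cnj m) \<noteq> 0"
        using \<open>m \<noteq> 0\<close> by (simp add: complex_eq_iff)
      ultimately show ?thesis by metis
    qed
  qed
  obtain \<eta> y where 1: "A \<eta> y = F" using first by blast
  obtain s' \<eta>' y' where 2: "A \<eta>' y' = 0" "B s' \<eta>' y' \<noteq> 0" using kernel by blast
  define r where "r = (h - B 0 \<eta> y) / B s' \<eta>' y'"
  have "A (\<eta> + r *\<^sub>R \<eta>') (y + r *\<^sub>R y') = F" using 1 2 by (simp add: A_add)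
  moreover have "B (0 + r * s') (\<eta> + r *\<^sub>R \<eta>') (y + r *\<^sub>R y') = h"
    using 2 by (simp only: B_add r_def) simp
  ultimately show ?thesis unfolding A_def B_def d_def by blast
qed

end

section \<open>The equations and the action\<close>

text \<open>The real coordinate comes first, both in the space \<open>\<real> \<times> \<complex>\<close> of the coordinates \<open>t\<close> and \<open>Y\<close> and in the
space of the values of one real and one complex equation.\<close>
definition vec3 :: "complex \<Rightarrow> real \<Rightarrow> real^3" where
  "vec3 w x = vector [x, Re w, Im w]"

definition complex_part :: "real^3 \<Rightarrow> complex" where
  "complex_part v = Complex (v $ 2) (v $ 3)"

lemma vec3_simps [simp]:
  "complex_part (vec3 w x) = w" "vec3 w x $ 1 = x" "vec3 (complex_part v) (v $ 1) = v"
  "vec3 w x $ 2 = Re w" "vec3 w x $ 3 = Im w" "Re (complex_part v) = v $ 2" "Im (complex_part v) = v $ 3"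
  by (simp_all add: vec3_def complex_part_def vec_eq_iff forall_3)

lemma vec3_eq_iff: "v = w \<longleftrightarrow> complex_part v = complex_part w \<and> v $ 1 = w $ 1"
  by (metis vec3_simps(3))

definition conj_if :: "bool \<Rightarrow> complex \<Rightarrow> complex" where
  "conj_if s w = (if s then cnj w else w)"

lemma conj_if_simps [simp]:
  "conj_if False w = w" "conj_if s 1 = 1" "conj_if s 0 = 0" "cmod (conj_if s w) = cmod w"
  "conj_if s (v * w) = conj_if s v * conj_if s w" "conj_if s (v - w) = conj_if s v - conj_if s w"
  "conj_if s (w ^ m) = conj_if s w ^ m" "conj_if s (conj_if s' w) = conj_if (s \<noteq> s') w"
  by (auto simp: conj_if_def)

text \<open>The linear map by which a group element transforms the values of the equations.\<close>
definition twist :: "complex \<Rightarrow> bool \<Rightarrow> real^3 \<Rightarrow> real^3" where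
  "twist u s v = vec3 (u * conj_if s (complex_part v)) (v $ 1)"

lemma det_diagonal_map: "det (matrix (\<lambda>v. \<chi> i. d i * v $ i)) = (\<Prod>i\<in>UNIV. d i)"
  for d :: "'b::finite \<Rightarrow> real"
proof -
  have "matrix (\<lambda>v. \<chi> i. d i * v $ i) = (\<chi> i j. if i = j then d i else 0)"
    by (auto simp: matrix_def vec_eq_iff axis_def)
  then show ?thesis by (simp add: det_diagonal)
qed

lemma prod_UNIV_3: "prod f (UNIV :: 3 set) = f 1 * f 2 * f 3"
  unfolding UNIV_3 by (simp add: ac_simps)

text \<open>Rotations are squares: the rotation by half the angle, given by a square root of the unit complex number,
  is the \<open>f\<close> to which this is applied.\<close>

lemma det_pos_of_square:
  fixes f g :: "real^'b::finite \<Rightarrow> real^'b"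
  assumes "linear f" "h \<circ> f = id" "f \<circ> f = g"
  shows "det (matrix g) > 0"
proof -
  have "inj f" using assms(2) by (metis inj_on_id inj_on_imageI2)
  then have "det (matrix f) \<noteq> 0" using det_nz_iff_inj[OF assms(1)] by simp
  moreover have "det (matrix g) = det (matrix f) * det (matrix f)"
    using matrix_compose[OF assms(1) assms(1)] assms(3) by (simp add: det_mul)
  ultimately show ?thesis by (metis not_real_square_gt_zero)
qed

lemma linear_twist: "linear (twist u s)"
  by (auto simp: linear_iff twist_def vec3_eq_iff complex_eq_iff conj_if_def algebra_simps)

lemma twist_twist: "twist u s (twist v s' x) = twist (u * conj_if s v) (s \<noteq> s') x"
  by (simp add: twist_def mult.assoc)

lemma cnj_mult_unit: "cmod u = 1 \<Longrightarrow> cnj u * u = 1"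
  by (metis complex_norm_square mult.commute of_real_1 one_power2)

lemma det_twist:
  assumes "cmod u = 1"
  shows "(if s then - 1 else 1) * det (matrix (twist u s)) > 0"
proof -
  \<comment> \<open>Elements without reflection are squares; one reflection is diagonal, so that its determinant is explicit.\<close>
  have sq: "csqrt u * csqrt u = u" by (metis power2_csqrt power2_eq_square)
  have "cmod (csqrt u) = 1" using assms by simp
  then have "twist (cnj (csqrt u)) False \<circ> twist (csqrt u) False = id"
    by (simp add: fun_eq_iff twist_twist cnj_mult_unit) (simp add: twist_def)
  then have pos: "det (matrix (twist u False)) > 0"
    by (rule det_pos_of_square[OF linear_twist]) (simp add: fun_eq_iff twist_twist sq)
  define d where "d i = (if i = 3 then - 1 else 1 :: real)" for i :: 3
  have "twist 1 True = (\<lambda>v. \<chi> i. d i * v $ i)"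
    by (simp add: fun_eq_iff twist_def vec_eq_iff forall_3 conj_if_def d_def)
  moreover have "(\<Prod>i\<in>UNIV. d i) = - 1" by (simp add: prod_UNIV_3 d_def)
  ultimately have "det (matrix (twist 1 True)) = - 1" using det_diagonal_map[of d] by metis
  moreover have "twist u True = twist u False \<circ> twist 1 True"
    by (simp add: fun_eq_iff twist_twist)
  ultimately show ?thesis
    using pos matrix_compose[OF linear_twist linear_twist] by (cases s) (simp_all add: det_mul)
qed

definition t_of :: "real^(3 + 'n::finite) \<Rightarrow> real" where "t_of q = q $ Inl 1"
definition Y_of :: "real^(3 + 'n::finite) \<Rightarrow> complex" where "Y_of q = Complex (q $ Inl 2) (q $ Inl 3)"
abbreviation z_of :: "real^(3 + 'n::finite) \<Rightarrow> real^'n" where "z_of \<equiv> tangent_part"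
definition point :: "real \<Rightarrow> complex \<Rightarrow> real^'n \<Rightarrow> real^(3 + 'n::finite)" where
  "point t Y z = join_parts (vec3 Y t) z"

lemma point_simps [simp]:
  "t_of (point t Y z) = t" "Y_of (point t Y z) = Y" "z_of (point t Y z) = z"
  "point (t_of q) (Y_of q) (z_of q) = q"
  by (auto simp: t_of_def Y_of_def point_def vec_sum_eq_iff forall_3)

lemma coordinates_eq_iff: "p = q \<longleftrightarrow> t_of p = t_of q \<and> Y_of p = Y_of q \<and> z_of p = z_of q"
  by (metis point_simps(4))

lemma point_eq_iff: "point t Y z = point t' Y' z' \<longleftrightarrow> t = t' \<and> Y = Y' \<and> z = z'"
  by (simp add: coordinates_eq_iff)

lemma linear_coordinates: "linear t_of" "linear Y_of" "linear z_of"
  by (auto simp: linear_iff t_of_def Y_of_def complex_eq_iff vec_eq_iff)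

lemma bounded_linear_coordinates: "bounded_linear t_of" "bounded_linear Y_of" "bounded_linear z_of"
  using linear_coordinates by (simp_all add: linear_conv_bounded_linear)

lemma coordinates_linear [simp]:
  "t_of (p + q) = t_of p + t_of q" "Y_of (p + q) = Y_of p + Y_of q" "z_of (p + q) = z_of p + z_of q"
  "t_of (r *\<^sub>R q) = r * t_of q" "Y_of (r *\<^sub>R q) = r *\<^sub>R Y_of q" "z_of (r *\<^sub>R q) = r *\<^sub>R z_of q"
  by (simp_all add: linear_add[OF linear_coordinates(1)] linear_scale[OF linear_coordinates(1)]
      linear_add[OF linear_coordinates(2)] linear_scale[OF linear_coordinates(2)]
      linear_add[OF linear_coordinates(3)] linear_scale[OF linear_coordinates(3)])

lemma inner_coordinates: "q \<bullet> q = (t_of q)\<^sup>2 + (cmod (Y_of q))\<^sup>2 + z_of q \<bullet> z_of q"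
  unfolding cmod_power2
  by (simp add: inner_vec_def sum_UNIV_sum_type t_of_def Y_of_def sum_3 power2_eq_square)

text \<open>The assumption on the product of the \<open>c i\<close> says that the complex dimension \<open>r\<close> is odd: it is the determinant
of complex conjugation.\<close>
locale dihedral_model = paired_coordinates \<sigma> c for \<sigma> :: "'n::finite \<Rightarrow> 'n" and c +
  fixes k :: nat
  assumes prod_c: "(\<Prod>i\<in>UNIV. c i) = - 1" and even_dim: "even CARD('n)" and odd_k: "odd k"
begin

lemma k_pos: "k > 0"
  using odd_k by (cases k) auto

definition milnor_eq where "milnor_eq q = cdot (z_of q) (z_of q) - (Y_of q - Y_of q ^ (k + 1))"
definition milnor_level :: "real^(3 + 'n) \<Rightarrow> real" where
  "milnor_level q = (t_of q)\<^sup>2 + z_of q \<bullet> z_of q + Y_of q \<bullet> Y_of q / 2 - 4"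
definition roots_eq :: "real^(3 + 'n) \<Rightarrow> complex" where "roots_eq q = Y_of q ^ k - 1"
definition sphere_level :: "real^(3 + 'n) \<Rightarrow> real" where "sphere_level q = (t_of q - 5)\<^sup>2 + z_of q \<bullet> z_of q - 1"

definition milnor_map where "milnor_map q = vec3 (milnor_eq q) (milnor_level q)"
definition sphere_map where "sphere_map q = vec3 (roots_eq q) (sphere_level q)"

text \<open>The two pieces of the manifold lie in disjoint open sets, so that they can be given by different
equations and carry different linear actions: on the first piece \<open>|t| \<le> 2\<close>, and on the second one
\<open>4 \<le> t \<le> 6\<close>.\<close>
definition milnor_part :: "(real^(3 + 'n)) set" where "milnor_part = {q. \<bar>t_of q\<bar> < 3}"
definition sphere_part :: "(real^(3 + 'n)) set" where "sphere_part = {q. t_of q > 3}"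

definition \<Phi> where "\<Phi> q = (if q \<in> milnor_part then milnor_map q else sphere_map q)"

text \<open>In both actions \<open>u\<close> is the root of unity by which the rotation part of a group element acts, and \<open>s\<close> says whether the
element is a reflection, in which case the reflection is applied before the rotation. The square in the action on \<open>Y\<close>
makes the equation \<open>z \<cdot> z = Y - Y^(k+1)\<close> equivariant.\<close>
definition milnor_act where
  "milnor_act u s q = point ((if s then - 1 else 1) * t_of q) (u\<^sup>2 * conj_if s (Y_of q))
     (cmul u (if s then conj_vec (z_of q) else z_of q))"
definition sphere_act :: "complex \<Rightarrow> bool \<Rightarrow> real^(3 + 'n) \<Rightarrow> real^(3 + 'n)" where
  "sphere_act u s q = point (t_of q) (u * conj_if s (Y_of q)) ((if s then - 1 else 1) *\<^sub>R z_of q)"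
definition act where "act u s q = (if q \<in> milnor_part then milnor_act u s q else sphere_act u s q)"

lemma milnor_act_milnor_act: "milnor_act u s (milnor_act v s' q) = milnor_act (u * conj_if s v) (s \<noteq> s') q"
  by (auto simp: milnor_act_def coordinates_eq_iff power_mult_distrib cmul_cmul conj_vec_cmul conj_if_def mult.assoc)

lemma sphere_act_sphere_act: "sphere_act u s (sphere_act v s' q) = sphere_act (u * conj_if s v) (s \<noteq> s') q"
  by (auto simp: sphere_act_def coordinates_eq_iff conj_if_def mult.assoc)

lemma act_milnor_part_iff: "act u s q \<in> milnor_part \<longleftrightarrow> q \<in> milnor_part"
  by (auto simp: act_def milnor_part_def milnor_act_def sphere_act_def)

lemma act_act: "act u s (act v s' q) = act (u * conj_if s v) (s \<noteq> s') q"
  using act_milnor_part_iff[of v s' q] by (auto simp: act_def milnor_act_milnor_act sphere_act_sphere_act)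

lemma act_one [simp]: "act 1 False q = q"
  by (simp add: act_def milnor_act_def sphere_act_def)

lemma linear_milnor_act: "linear (milnor_act u s)"
proof -
  note rules = linear_add[OF linear_vec_maps(1)] linear_scale[OF linear_vec_maps(1)]
    linear_add[OF linear_vec_maps(4)] linear_scale[OF linear_vec_maps(4)]
  show ?thesis
    by (simp add: linear_iff milnor_act_def coordinates_eq_iff conj_if_def rules distrib_left)
qed

lemma linear_sphere_act: "linear (sphere_act u s)"
  by (auto simp: linear_iff sphere_act_def coordinates_eq_iff conj_if_def algebra_simps)

text \<open>On the ambient space the reflection changes the signs of \<open>t\<close>, of the imaginary part of \<open>Y\<close> and of \<open>r\<close>
coordinates of \<open>z\<close>, an odd number in total, and on the values of the equations it changes one sign.\<close>
lemma det_milnor_act: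
  assumes "cmod u = 1"
  shows "det (matrix (milnor_act u s)) * det (matrix (twist (u\<^sup>2) s)) > 0"
proof -
  have sq: "csqrt u * csqrt u = u" by (metis power2_csqrt power2_eq_square)
  have "cmod (csqrt u) = 1" using assms by simp
  then have "milnor_act (cnj (csqrt u)) False \<circ> milnor_act (csqrt u) False = id"
    by (simp add: fun_eq_iff milnor_act_milnor_act cnj_mult_unit) (simp add: milnor_act_def)
  then have pos: "det (matrix (milnor_act u False)) > 0"
    by (rule det_pos_of_square[OF linear_milnor_act]) (simp add: fun_eq_iff milnor_act_milnor_act sq)
  define d where "d = case_sum (\<lambda>a. if a = (2::3) then 1 else - 1) c"
  have "milnor_act 1 True = (\<lambda>q. \<chi> i. d i * q $ i)"
    by (simp add: fun_eq_iff milnor_act_def vec_sum_eq_iff forall_3 conj_if_def point_def d_def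
        t_of_def Y_of_def conj_vec_def)
  moreover have "(\<Prod>i\<in>UNIV. d i) = - 1" by (simp add: prod_UNIV_sum_type prod_UNIV_3 d_def prod_c)
  ultimately have "det (matrix (milnor_act 1 True)) = - 1" using det_diagonal_map[of d] by metis
  moreover have "milnor_act u True = milnor_act u False \<circ> milnor_act 1 True"
    by (simp add: fun_eq_iff milnor_act_milnor_act)
  ultimately have "(if s then - 1 else 1) * det (matrix (milnor_act u s)) > 0"
    using pos matrix_compose[OF linear_milnor_act linear_milnor_act] by (cases s) (simp_all add: det_mul)
  moreover have "cmod (u\<^sup>2) = 1" using assms by (simp add: norm_power)
  ultimately show ?thesis using det_twist[of "u\<^sup>2" s] by (cases s) (auto simp: mult_neg_neg)
qed

text \<open>Here the reflection changes the signs of the imaginary part of \<open>Y\<close> and of all \<open>n\<close> coordinates of \<open>z\<close>, again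
an odd number.\<close>
lemma det_sphere_act:
  assumes "cmod u = 1"
  shows "det (matrix (sphere_act u s)) * det (matrix (twist 1 s)) > 0"
proof -
  have sq: "csqrt u * csqrt u = u" by (metis power2_csqrt power2_eq_square)
  have "cmod (csqrt u) = 1" using assms by simp
  then have "sphere_act (cnj (csqrt u)) False \<circ> sphere_act (csqrt u) False = id"
    by (simp add: fun_eq_iff sphere_act_sphere_act cnj_mult_unit) (simp add: sphere_act_def)
  then have pos: "det (matrix (sphere_act u False)) > 0"
    by (rule det_pos_of_square[OF linear_sphere_act]) (simp add: fun_eq_iff sphere_act_sphere_act sq)
  define d where "d = case_sum (\<lambda>a. if a = (3::3) then - 1 else 1) (\<lambda>_::'n. - 1 :: real)"
  have "sphere_act 1 True = (\<lambda>q. \<chi> i. d i * q $ i)"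
    by (simp add: fun_eq_iff sphere_act_def vec_sum_eq_iff forall_3 conj_if_def point_def d_def
        t_of_def Y_of_def)
  moreover have "(\<Prod>i\<in>UNIV. d i) = - 1"
    using even_dim by (simp add: prod_UNIV_sum_type prod_UNIV_3 d_def)
  ultimately have "det (matrix (sphere_act 1 True)) = - 1" using det_diagonal_map[of d] by metis
  moreover have "sphere_act u True = sphere_act u False \<circ> sphere_act 1 True"
    by (simp add: fun_eq_iff sphere_act_sphere_act)
  ultimately have "(if s then - 1 else 1) * det (matrix (sphere_act u s)) > 0"
    using pos matrix_compose[OF linear_sphere_act linear_sphere_act] by (cases s) (simp_all add: det_mul)
  then show ?thesis using det_twist[of 1 s] by (cases s) (auto simp: mult_neg_neg)
qed

lemma milnor_map_milnor_act:
  assumes "cmod u = 1" "u ^ k = 1"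
  shows "milnor_map (milnor_act u s q) = twist (u\<^sup>2) s (milnor_map q)"
proof -
  have "(u\<^sup>2) ^ k = 1" using assms(2) by (metis power_mult mult.commute power_one)
  then show ?thesis
    using assms(1)
    by (auto simp: milnor_map_def twist_def milnor_eq_def milnor_level_def milnor_act_def cdot_cmul cdot_conj_vec inner_cmul
        power_mult_distrib conj_if_def algebra_simps norm_mult norm_power
        simp flip: power2_norm_eq_inner[where 'a = complex])
qed

lemma sphere_map_sphere_act:
  assumes "u ^ k = 1"
  shows "sphere_map (sphere_act u s q) = twist 1 s (sphere_map q)"
  using assms
  by (auto simp: sphere_map_def twist_def roots_eq_def sphere_level_def sphere_act_def power_mult_distrib conj_if_def)

definition \<Omega> where "\<Omega> = milnor_part \<union> sphere_part"

lemma open_parts: "open milnor_part" "open sphere_part"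
proof -
  have "continuous_on UNIV t_of"
    using linear_continuous_on[OF bounded_linear_coordinates(1)] .
  then show "open milnor_part" "open sphere_part"
    unfolding milnor_part_def sphere_part_def by (auto intro!: open_Collect_less continuous_intros)
qed

lemma milnor_level_in_part:
  assumes "milnor_level q = 0"
  shows "q \<in> milnor_part"
proof -
  have "(t_of q)\<^sup>2 \<le> 4"
    using assms inner_ge_zero[of "z_of q"] inner_ge_zero[of "Y_of q"] unfolding milnor_level_def by linarith
  then have "\<bar>t_of q\<bar> \<le> 2" using abs_le_square_iff[of "t_of q" 2] by simp
  then show ?thesis by (simp add: milnor_part_def)
qed

lemma sphere_level_in_part:
  assumes "sphere_level q = 0"
  shows "q \<in> sphere_part" "\<bar>t_of q - 5\<bar> \<le> 1"
proof -
  have "(t_of q - 5)\<^sup>2 \<le> 1"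
    using assms inner_ge_zero[of "z_of q"] unfolding sphere_level_def by linarith
  then show 1: "\<bar>t_of q - 5\<bar> \<le> 1" using abs_le_square_iff[of "t_of q - 5" 1] by simp
  then show "q \<in> sphere_part" by (simp add: sphere_part_def)
qed

lemma vec3_eq_0 [simp]: "vec3 w x = 0 \<longleftrightarrow> w = 0 \<and> x = 0"
  by (auto simp: vec3_eq_iff complex_eq_iff)

lemma level_set_iff:
  "q \<in> {q \<in> \<Omega>. \<Phi> q = 0} \<longleftrightarrow> milnor_eq q = 0 \<and> milnor_level q = 0 \<or> roots_eq q = 0 \<and> sphere_level q = 0"
proof -
  have "q \<in> sphere_part \<Longrightarrow> q \<notin> milnor_part" by (auto simp: milnor_part_def sphere_part_def)
  then show ?thesis
    using milnor_level_in_part[of q] sphere_level_in_part(1)[of q]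
    by (auto simp: \<Omega>_def \<Phi>_def milnor_map_def sphere_map_def)
qed

lemma bounded_bilinear_cdot: "bounded_bilinear cdot"
  unfolding bilinear_conv_bounded_bilinear[symmetric] bilinear_def
  using linear_vec_maps(1,2)
  by (auto simp: linear_iff cdot_def inner_add_left inner_add_right complex_eq_iff algebra_simps)

lemma Ck_equations:
  assumes "open S"
  shows "Ck_on m S milnor_eq" "Ck_on m S milnor_level" "Ck_on m S roots_eq" "Ck_on m S sphere_level"
proof -
  note lin = bounded_linear_coordinates[THEN Ck_on_bounded_linear, of m S]
  note rules = Ck_on_diff Ck_on_add Ck_on_power Ck_on_const assms lin
    bounded_bilinear.Ck_on[OF bounded_bilinear_inner] bounded_bilinear.Ck_on[OF bounded_bilinear_cdot]
  show "Ck_on m S milnor_eq" unfolding milnor_eq_def[abs_def] by (intro rules)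
  have "Ck_on m S (\<lambda>q. (1 / 2) * (Y_of q \<bullet> Y_of q))"
    by (intro bounded_bilinear.Ck_on[OF bounded_bilinear_mult] rules)
  then have "Ck_on m S (\<lambda>q. Y_of q \<bullet> Y_of q / 2)" by simp
  then show "Ck_on m S milnor_level" unfolding milnor_level_def[abs_def] by (intro rules)
  show "Ck_on m S roots_eq" unfolding roots_eq_def[abs_def] by (intro rules)
  show "Ck_on m S sphere_level" unfolding sphere_level_def[abs_def] by (intro rules)
qed

lemma Ck_vec3:
  assumes "open S" "Ck_on m S f" "Ck_on m S h"
  shows "Ck_on m S (\<lambda>q. vec3 (f q) (h q))"
proof (rule Ck_on_vec[OF assms(1)])
  fix i :: 3
  show "Ck_on m S (\<lambda>q. vec3 (f q) (h q) $ i)"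
    using exhaust_3[of i] Ck_on_linear_comp[OF bounded_linear_Re assms(1,2)]
      Ck_on_linear_comp[OF bounded_linear_Im assms(1,2)] assms(3) by auto
qed

lemma smooth_\<Phi>: "smooth_on \<Omega> \<Phi>"
  unfolding smooth_on_def \<Omega>_def
proof (intro allI Ck_on_Un open_parts)
  fix m
  show "Ck_on m milnor_part \<Phi>"
    by (rule Ck_on_cong[OF open_parts(1) _ Ck_vec3[OF open_parts(1) Ck_equations(1,2)[OF open_parts(1)]]])
      (simp add: \<Phi>_def milnor_map_def)
  show "Ck_on m sphere_part \<Phi>"
    by (rule Ck_on_cong[OF open_parts(2) _ Ck_vec3[OF open_parts(2) Ck_equations(3,4)[OF open_parts(2)]]])
      (auto simp: \<Phi>_def sphere_map_def milnor_part_def sphere_part_def)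
qed

lemma compact_level_set: "compact {q \<in> \<Omega>. \<Phi> q = 0}"
proof -
  have cont: "continuous_on UNIV milnor_eq" "continuous_on UNIV milnor_level" "continuous_on UNIV roots_eq" "continuous_on UNIV sphere_level"
    using Ck_equations[of UNIV 0] by simp_all
  have eq: "{q \<in> \<Omega>. \<Phi> q = 0} = {q. milnor_eq q = 0 \<and> milnor_level q = 0} \<union> {q. roots_eq q = 0 \<and> sphere_level q = 0}"
    using level_set_iff by blast
  have "closed {q \<in> \<Omega>. \<Phi> q = 0}"
    unfolding eq by (intro closed_Un closed_Collect_conj closed_Collect_eq cont continuous_on_const)
  moreover have "norm q \<le> 8" if "q \<in> {q \<in> \<Omega>. \<Phi> q = 0}" for q
  proof -
    from that consider "milnor_level q = 0" | "roots_eq q = 0" "sphere_level q = 0" using level_set_iff by blast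
    then have "q \<bullet> q \<le> 64"
    proof cases
      case 1
      then show ?thesis
        using zero_le_power2[of "t_of q"] inner_ge_zero[of "z_of q"] inner_ge_zero[of "Y_of q"]
        unfolding inner_coordinates milnor_level_def power2_norm_eq_inner[of "Y_of q"] by linarith
    next
      case 2
      have "cmod (Y_of q) ^ k = 1" using 2(1) by (simp add: roots_eq_def flip: norm_power)
      then have "cmod (Y_of q) = 1" using power_eq_imp_eq_base[of "cmod (Y_of q)" k 1] k_pos by simp
      moreover have "\<bar>t_of q\<bar> \<le> 6" using sphere_level_in_part(2)[OF 2(2)] by simp
      then have "(t_of q)\<^sup>2 \<le> 6\<^sup>2" using abs_le_square_iff[of "t_of q" 6] by simp
      moreover have "z_of q \<bullet> z_of q \<le> 1"
        using 2(2) zero_le_power2[of "t_of q - 5"] unfolding sphere_level_def by linarith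
      ultimately show ?thesis unfolding inner_coordinates by simp
    qed
    then show ?thesis by (simp add: norm_le_square)
  qed
  then have "bounded {q \<in> \<Omega>. \<Phi> q = 0}" unfolding bounded_iff by blast
  ultimately show ?thesis using compact_eq_bounded_closed by blast
qed

lemma vec3_has_derivative:
  assumes "(f has_derivative f') (at x)" "(h has_derivative h') (at x)"
  shows "((\<lambda>q. vec3 (f q) (h q)) has_derivative (\<lambda>v. vec3 (f' v) (h' v))) (at x)"
proof -
  have "linear (\<lambda>(w, x). vec3 w x)"
    by (auto simp: linear_iff vec3_eq_iff complex_eq_iff)
  then have "bounded_linear (\<lambda>(w, x). vec3 w x)" by (simp add: linear_conv_bounded_linear)
  from bounded_linear.has_derivative[OF this has_derivative_Pair[OF assms]]
  show ?thesis by simp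
qed

lemma cdot_commute: "cdot y z = cdot z y"
  unfolding cdot_def inner_maps(1)[of y z] inner_maps(2)[of y z]
  by (simp only: inner_commute[of z])

text \<open>On the spheres, \<open>Y^k\<close> has nonzero derivative because \<open>Y \<noteq> 0\<close>, and the radial vector is transversal to the
sphere. The Milnor fibre piece is covered by \<open>equation_surjective\<close>.\<close>
lemma regular_level:
  assumes "q \<in> \<Omega>" "\<Phi> q = 0"
  shows "surj (frechet_derivative \<Phi> (at q))"
proof -
  note lin = bounded_linear_coordinates[THEN bounded_linear_imp_has_derivative]
  have surj: "surj (frechet_derivative \<Phi> (at q))"
    if "(\<Phi> has_derivative (\<lambda>v. vec3 (Df v) (Dh v))) (at q)"
      "\<And>F h. \<exists>v. Df v = F \<and> Dh v = h" for Df Dh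
    unfolding frechet_derivative_at[OF that(1), symmetric]
  proof (rule surjI)
    fix w
    have "\<exists>v. Df v = complex_part w \<and> Dh v = w $ 1" by (rule that(2))
    then show "vec3 (Df (SOME v. Df v = complex_part w \<and> Dh v = w $ 1))
        (Dh (SOME v. Df v = complex_part w \<and> Dh v = w $ 1)) = w"
      by (rule someI2_ex) simp
  qed
  have "milnor_eq q = 0 \<and> milnor_level q = 0 \<or> roots_eq q = 0 \<and> sphere_level q = 0" using level_set_iff assms by blast
  then show ?thesis
  proof
    assume q: "milnor_eq q = 0 \<and> milnor_level q = 0"
    define Df where "Df v = 2 * cdot (z_of q) (z_of v) - (1 - of_nat (k + 1) * Y_of q ^ k) * Y_of v"
      for v :: "real^(3 + 'n)"
    define Dh where "Dh v = 2 * t_of q * t_of v + 2 * (z_of q \<bullet> z_of v) + Y_of q \<bullet> Y_of v"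
      for v :: "real^(3 + 'n)"
    have "(milnor_eq has_derivative Df) (at q)"
      unfolding milnor_eq_def[abs_def]
      by (rule has_derivative_eq_rhs)
        (rule has_derivative_diff has_derivative_power lin bounded_bilinear.FDERIV[OF bounded_bilinear_cdot]
          | simp add: fun_eq_iff Df_def cdot_commute[of "z_of _" "z_of q"] algebra_simps)+
    moreover have "(milnor_level has_derivative Dh) (at q)"
      unfolding milnor_level_def[abs_def] power2_eq_square
      by (auto intro!: derivative_eq_intros lin simp: Dh_def fun_eq_iff inner_commute algebra_simps)
    ultimately have D1: "(milnor_map has_derivative (\<lambda>v. vec3 (Df v) (Dh v))) (at q)"
      unfolding milnor_map_def[abs_def] by (rule vec3_has_derivative)
    have "(\<Phi> has_derivative (\<lambda>v. vec3 (Df v) (Dh v))) (at q)"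
      by (rule has_derivative_transform_within_open[OF D1 open_parts(1)])
        (use q milnor_level_in_part in \<open>auto simp: \<Phi>_def\<close>)
    then show ?thesis
    proof (rule surj)
      fix F h
      have "cdot (z_of q) (z_of q) = Y_of q - Y_of q ^ (k + 1)"
        "(t_of q)\<^sup>2 + z_of q \<bullet> z_of q + (cmod (Y_of q))\<^sup>2 / 2 = 4"
        using q by (simp_all add: milnor_eq_def milnor_level_def power2_norm_eq_inner)
      from equation_surjective[OF k_pos this, of F h]
      obtain s \<eta> y where "2 * cdot (z_of q) y - (1 - of_nat (k + 1) * Y_of q ^ k) * \<eta> = F"
        "2 * t_of q * s + 2 * (z_of q \<bullet> y) + Y_of q \<bullet> \<eta> = h" by blast
      then have "Df (point s \<eta> y) = F \<and> Dh (point s \<eta> y) = h" by (simp add: Df_def Dh_def)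
      then show "\<exists>v. Df v = F \<and> Dh v = h" by blast
    qed
  next
    assume q: "roots_eq q = 0 \<and> sphere_level q = 0"
    define Df where "Df v = of_nat k * Y_of q ^ (k - 1) * Y_of v" for v :: "real^(3 + 'n)"
    define Dh where "Dh v = 2 * (t_of q - 5) * t_of v + 2 * (z_of q \<bullet> z_of v)" for v :: "real^(3 + 'n)"
    have "(roots_eq has_derivative Df) (at q)"
      unfolding roots_eq_def[abs_def]
      by (rule has_derivative_eq_rhs)
        (rule has_derivative_diff has_derivative_power has_derivative_const lin
          | simp add: fun_eq_iff Df_def algebra_simps)+
    moreover have "(sphere_level has_derivative Dh) (at q)"
      unfolding sphere_level_def[abs_def] power2_eq_square
      by (auto intro!: derivative_eq_intros lin simp: Dh_def fun_eq_iff inner_commute algebra_simps)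
    ultimately have D2: "(sphere_map has_derivative (\<lambda>v. vec3 (Df v) (Dh v))) (at q)"
      unfolding sphere_map_def[abs_def] by (rule vec3_has_derivative)
    have "(\<Phi> has_derivative (\<lambda>v. vec3 (Df v) (Dh v))) (at q)"
      by (rule has_derivative_transform_within_open[OF D2 open_parts(2)])
        (use q sphere_level_in_part(1) in \<open>auto simp: \<Phi>_def milnor_part_def sphere_part_def\<close>)
    then show ?thesis
    proof (rule surj)
      fix F h
      have "Y_of q \<noteq> 0" using q k_pos by (auto simp: roots_eq_def power_0_left)
      then have "Df (point s (F / (of_nat k * Y_of q ^ (k - 1))) y) = F" for s y
        using k_pos by (simp add: Df_def)
      moreover have "Dh (point (h / 2 * (t_of q - 5)) \<eta> ((h / 2) *\<^sub>R z_of q)) = h" for \<eta>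
      proof -
        have "Dh (point (h / 2 * (t_of q - 5)) \<eta> ((h / 2) *\<^sub>R z_of q)) =
            h * ((t_of q - 5)\<^sup>2 + z_of q \<bullet> z_of q)"
          by (simp add: Dh_def power2_eq_square algebra_simps)
        then show ?thesis using q by (simp add: sphere_level_def)
      qed
      ultimately show "\<exists>v. Df v = F \<and> Dh v = h" by blast
    qed
  qed
qed

lemma regular_level_set: "inj e \<Longrightarrow> regular_level_set \<Phi> \<Omega> e"
  using open_parts smooth_\<Phi> compact_level_set regular_level
  by unfold_locales (auto simp: \<Omega>_def)

lemma act_preserves_level:
  assumes "cmod u = 1" "u ^ k = 1" "q \<in> \<Omega>"
  shows "act u s q \<in> \<Omega>" "\<Phi> (act u s q) = (if q \<in> milnor_part then twist (u\<^sup>2) s (\<Phi> q) else twist 1 s (\<Phi> q))"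
proof -
  show "act u s q \<in> \<Omega>"
    using assms(3) act_milnor_part_iff[of u s q] by (auto simp: \<Omega>_def act_def sphere_part_def sphere_act_def)
  show "\<Phi> (act u s q) = (if q \<in> milnor_part then twist (u\<^sup>2) s (\<Phi> q) else twist 1 s (\<Phi> q))"
    using act_milnor_part_iff[of u s q] by (simp add: \<Phi>_def milnor_map_milnor_act sphere_map_sphere_act assms act_def)
qed

lemma compatible_act:
  fixes e :: "real^(3 + 'n) \<Rightarrow> 'p"
  assumes "inj e" "cmod u = 1" "u ^ k = 1"
  shows "regular_level_set.compatible \<Phi> \<Omega> (act u s)"
proof -
  interpret regular_level_set \<Phi> \<Omega> e by (rule regular_level_set[OF assms(1)])
  have bl: "bounded_linear (milnor_act u s)" "bounded_linear (sphere_act u s)"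
    using linear_milnor_act linear_sphere_act by (simp_all add: linear_conv_bounded_linear)
  have eq: "milnor_act u s q = act u s q" if "q \<in> milnor_part" for q using that by (simp add: act_def)
  have eq': "sphere_act u s q = act u s q" if "q \<in> sphere_part" for q
    using that by (auto simp: act_def milnor_part_def sphere_part_def)
  have "smooth_on \<Omega> (act u s)"
    unfolding smooth_on_def \<Omega>_def
    by (intro allI Ck_on_Un open_parts Ck_on_cong[OF open_parts(1) eq]
        Ck_on_cong[OF open_parts(2) eq'] Ck_on_bounded_linear bl)
  moreover have "act u s ` N \<subseteq> N"
  proof clarify
    fix q assume "q \<in> N"
    then have "q \<in> \<Omega>" "\<Phi> q = 0" by (auto simp: N_def)
    then show "act u s q \<in> N"
      using act_preserves_level[OF assms(2,3), of q s] linear_0[OF linear_twist] by (simp add: N_def)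
  qed
  moreover have "\<exists>W L. open W \<and> q \<in> W \<and> linear L \<and> (\<forall>r\<in>W. \<Phi> (act u s r) = L (\<Phi> r)) \<and>
      jacobian_det (act u s) q * det (matrix L) > 0" if "q \<in> N" for q
  proof (cases "q \<in> milnor_part")
    case True
    have "(act u s has_derivative milnor_act u s) (at q)"
      by (rule has_derivative_transform_within_open[OF bounded_linear_imp_has_derivative[OF bl(1)]
            open_parts(1) True eq])
    then have "jacobian_det (act u s) q * det (matrix (twist (u\<^sup>2) s)) > 0"
      using det_milnor_act[OF assms(2)] by (simp add: jacobian_det_def flip: frechet_derivative_at)
    then show ?thesis
      using True open_parts(1) linear_twist act_preserves_level(2)[OF assms(2,3)]
      by (intro exI[of _ milnor_part] exI[of _ "twist (u\<^sup>2) s"]) (auto simp: \<Omega>_def)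
  next
    case False
    moreover have "q \<in> \<Omega>" using that by (simp add: N_def)
    ultimately have sphere_part: "q \<in> sphere_part" by (simp add: \<Omega>_def)
    have "(act u s has_derivative sphere_act u s) (at q)"
      by (rule has_derivative_transform_within_open[OF bounded_linear_imp_has_derivative[OF bl(2)]
            open_parts(2) sphere_part eq'])
    then have "jacobian_det (act u s) q * det (matrix (twist 1 s)) > 0"
      using det_sphere_act[OF assms(2)] by (simp add: jacobian_det_def flip: frechet_derivative_at)
    then show ?thesis
      using sphere_part open_parts(2) linear_twist act_preserves_level(2)[OF assms(2,3)]
      by (intro exI[of _ sphere_part] exI[of _ "twist 1 s"]) (auto simp: \<Omega>_def milnor_part_def sphere_part_def)
  qed
  ultimately show ?thesis unfolding compatible_def by blast
qed

end

section \<open>Points with nontrivial isotropy\<close>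

context dihedral_model
begin

definition lower_poles :: "(real^(3 + 'n)) set" where "lower_poles = {point 4 Y 0 |Y. Y ^ k = 1}"
definition upper_poles :: "(real^(3 + 'n)) set" where "upper_poles = {point 6 Y 0 |Y. Y ^ k = 1}"
definition rotation_poles :: "(real^(3 + 'n)) set" where "rotation_poles = {point 2 0 0, point (- 2) 0 0}"

lemma special_points_in_level: "lower_poles \<union> upper_poles \<union> rotation_poles \<subseteq> {q \<in> \<Omega>. \<Phi> q = 0}"
proof
  fix q assume "q \<in> lower_poles \<union> upper_poles \<union> rotation_poles"
  then show "q \<in> {q \<in> \<Omega>. \<Phi> q = 0}"
    unfolding level_set_iff
    by (auto simp: lower_poles_def upper_poles_def rotation_poles_def milnor_eq_def milnor_level_def roots_eq_def sphere_level_def cdot_def)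
qed

text \<open>A fixed point of the reflection has \<open>t = 0\<close> and real coordinates \<open>z\<close> and \<open>Y = y\<close> with
\<open>|z|\<^sup>2 = y - y^(k+1)\<close>. As \<open>k + 1\<close> is even, \<open>y\<close> lies between 0 and 1, which keeps
\<open>|z|\<^sup>2 + y\<^sup>2 / 2\<close> below the level 4.\<close>

lemma standard_reflection_free:
  assumes "milnor_eq q = 0" "milnor_level q = 0" "milnor_act 1 True q = q"
  shows False
proof -
  have q: "t_of q = 0" "cnj (Y_of q) = Y_of q" "conj_vec (z_of q) = z_of q"
    using assms(3) by (auto simp: milnor_act_def coordinates_eq_iff conj_if_def)
  obtain y where y: "Y_of q = of_real y" using q(2) by (metis Reals_cases Reals_cnj_iff)
  have "cdot (z_of q) (z_of q) = of_real (z_of q \<bullet> z_of q)"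
    using inner_rels(6)[of "z_of q"] q(3) by (simp add: cdot_def)
  then have "complex_of_real (z_of q \<bullet> z_of q) = of_real (y - y ^ (k + 1))"
    using assms(1) by (simp add: milnor_eq_def y)
  then have zz: "z_of q \<bullet> z_of q = y - y ^ (k + 1)" by (simp only: of_real_eq_iff)
  have pow: "y ^ (k + 1) \<ge> 0" using odd_k zero_le_even_power[of "k + 1" y] by simp
  then have "y \<ge> 0" using zz inner_ge_zero[of "z_of q"] by linarith
  have "y \<le> 1"
  proof (rule ccontr)
    assume "\<not> y \<le> 1"
    then have "y ^ 1 < y ^ (k + 1)" using k_pos by (intro power_strict_increasing) auto
    then show False using zz inner_ge_zero[of "z_of q"] by simp
  qed
  then have "y\<^sup>2 \<le> 1" using \<open>y \<ge> 0\<close> by (simp add: power_le_one)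
  then show False
    using assms(2) q(1) zz pow \<open>y \<le> 1\<close> by (simp add: milnor_level_def y power2_eq_square inner_complex_def)
qed

text \<open>For odd \<open>k\<close> every \<open>k\<close>-th root of unity \<open>u\<close> is the square of another one \<open>v\<close>. Conjugation by the rotation \<open>v\<close>
turns the standard reflection into the reflection belonging to \<open>u\<close>.\<close>
lemma reflection_free:
  assumes "milnor_eq q = 0" "milnor_level q = 0" "u ^ k = 1" "cmod u = 1"
  shows "milnor_act u True q \<noteq> q"
proof
  assume fixed: "milnor_act u True q = q"
  \<comment> \<open>The root with square \<open>u\<close> is \<open>u^((k+1)/2)\<close>.\<close>
  obtain m where m: "k + 1 = 2 * m" using odd_k by (metis evenE odd_even_add odd_one)
  define v where "v = u ^ m"
  have v: "cmod v = 1" "v ^ k = 1" using assms(3,4)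
    by (simp_all add: v_def norm_power) (metis power_mult mult.commute power_one)
  have "v * v = u ^ (k + 1)" unfolding m v_def by (simp add: mult_2 power_add)
  then have vv: "v * v = u" using assms(3) by simp
  define p where "p = milnor_act (cnj v) False q"
  have "(cnj v) ^ k = 1" using v(2) by (metis complex_cnj_one complex_cnj_power)
  then have "milnor_map p = twist ((cnj v)\<^sup>2) False (milnor_map q)"
    unfolding p_def using v(1) by (intro milnor_map_milnor_act) simp_all
  moreover have "milnor_map q = 0" using assms(1,2) by (simp add: milnor_map_def)
  ultimately have "milnor_map p = 0" by (simp add: linear_0[OF linear_twist])
  then have p: "milnor_eq p = 0" "milnor_level p = 0" by (simp_all add: milnor_map_def)
  have "milnor_act 1 True p = milnor_act v True q"
    unfolding p_def milnor_act_milnor_act by (simp add: conj_if_def)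
  also have "\<dots> = milnor_act (cnj v) False (milnor_act u True q)"
    unfolding milnor_act_milnor_act using cnj_mult_unit[OF v(1)] vv by (simp add: mult.assoc[symmetric] flip: vv)
  also have "\<dots> = p" by (simp add: fixed p_def)
  finally show False using standard_reflection_free[OF p] by simp
qed

lemma fixed_point_cases:
  assumes "q \<in> {q \<in> \<Omega>. \<Phi> q = 0}" "act u s q = q" "u ^ k = 1" "cmod u = 1" "s \<or> u \<noteq> 1"
  shows "q \<in> lower_poles \<union> upper_poles \<or> q \<in> rotation_poles \<and> \<not> s"
  using assms(1) unfolding level_set_iff
proof
  assume q: "milnor_eq q = 0 \<and> milnor_level q = 0"
  then have fixed: "milnor_act u s q = q" using assms(2) milnor_level_in_part[of q] by (simp add: act_def)
  then have s: "\<not> s" using reflection_free[of q u] q assms(3,4) by (cases s) auto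
  then have "u \<noteq> 1" using assms(5) by simp
  have *: "u\<^sup>2 * Y_of q = Y_of q" "cmul u (z_of q) = z_of q"
    using fixed s by (auto simp: milnor_act_def coordinates_eq_iff)
  \<comment> \<open>A root of unity of odd order that squares to 1 is 1.\<close>
  have "u\<^sup>2 \<noteq> 1"
  proof
    assume u: "u\<^sup>2 = 1"
    obtain m where "k = 2 * m + 1" using odd_k by (metis oddE)
    then have "u ^ k = (u\<^sup>2) ^ m * u" by (simp add: power_mult)
    then show False using u assms(3) \<open>u \<noteq> 1\<close> by simp
  qed
  then have Y: "Y_of q = 0" using *(1) by simp
  have "z_of q \<bullet> cmul u (z_of q) = Re u * (z_of q \<bullet> z_of q)"
    by (simp add: cmul_def inner_add_right)
  then have "z_of q \<bullet> z_of q = Re u * (z_of q \<bullet> z_of q)" using *(2) by simp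
  moreover have "Re u \<noteq> 1"
    using \<open>u \<noteq> 1\<close> assms(4) by (auto simp: complex_eq_iff cmod_def)
  ultimately have z: "z_of q = 0" by simp
  then have "(t_of q)\<^sup>2 = 2\<^sup>2" using q Y by (simp add: milnor_level_def)
  then have "t_of q = 2 \<or> t_of q = - 2" by (simp only: power2_eq_iff)
  then show ?thesis using Y z s by (auto simp: rotation_poles_def coordinates_eq_iff)
next
  assume q: "roots_eq q = 0 \<and> sphere_level q = 0"
  then have "q \<notin> milnor_part" using sphere_level_in_part(1)[of q] by (auto simp: milnor_part_def sphere_part_def)
  then have fixed: "u * conj_if s (Y_of q) = Y_of q" "(if s then - 1 else 1 :: real) *\<^sub>R z_of q = z_of q"
    using assms(2) by (auto simp: act_def sphere_act_def coordinates_eq_iff)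
  have Y: "Y_of q ^ k = 1" using q by (simp add: roots_eq_def)
  then have "Y_of q \<noteq> 0" using k_pos by (auto simp: power_0_left)
  then have s using fixed(1) assms(5) by (cases s) auto
  then have "- z_of q = z_of q" using fixed(2) by simp
  then have z: "z_of q = 0" by (simp add: vec_eq_iff)
  then have "(t_of q - 5)\<^sup>2 = 1" using q by (simp add: sphere_level_def)
  then have "t_of q = 4 \<or> t_of q = 6" by (auto simp: power2_eq_1_iff)
  then show ?thesis using Y z by (auto simp: lower_poles_def upper_poles_def coordinates_eq_iff)
qed

lemma finite_special: "finite (lower_poles \<union> upper_poles \<union> rotation_poles)"
proof -
  have "finite {Y :: complex. Y ^ k = 1}" using k_pos by (intro finite_roots_unity) auto
  then have "finite ((\<lambda>Y. point 4 Y (0 :: real^'n)) ` {Y. Y ^ k = 1})"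
    "finite ((\<lambda>Y. point 6 Y (0 :: real^'n)) ` {Y. Y ^ k = 1})" by blast+
  moreover have "lower_poles = (\<lambda>Y. point 4 Y 0) ` {Y. Y ^ k = 1}" "upper_poles = (\<lambda>Y. point 6 Y 0) ` {Y. Y ^ k = 1}"
    by (auto simp: lower_poles_def upper_poles_def)
  ultimately show ?thesis by (simp add: rotation_poles_def)
qed

end

section \<open>The dihedral group and its singular orbits\<close>

text \<open>The permutations that form \<open>BijGroup E\<close> are required to be undefined outside of \<open>E\<close>, whence the restriction.\<close>
lemma group_action_restrictI:
  assumes "group G" "\<And>g x. g \<in> carrier G \<Longrightarrow> x \<in> E \<Longrightarrow> F g x \<in> E"
    and mult: "\<And>g h x. g \<in> carrier G \<Longrightarrow> h \<in> carrier G \<Longrightarrow> x \<in> E \<Longrightarrow> F (g \<otimes>\<^bsub>G\<^esub> h) x = F g (F h x)"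
    and one: "\<And>x. x \<in> E \<Longrightarrow> F \<one>\<^bsub>G\<^esub> x = x"
  shows "group_action G E (\<lambda>g. restrict (F g) E)"
proof -
  interpret group G by fact
  have "restrict (F g) E \<in> Bij E" if g: "g \<in> carrier G" for g
  proof -
    have "bij_betw (F g) E E"
      by (rule bij_betw_byWitness[where f' = "F (inv\<^bsub>G\<^esub> g)"])
        (use g assms(2) in \<open>auto simp: one simp flip: mult\<close>)
    then show ?thesis by (simp add: Bij_def bij_betw_restrict_eq)
  qed
  then have "(\<lambda>g. restrict (F g) E) \<in> hom G (BijGroup E)"
    using assms(2) by (auto simp: hom_def BijGroup_def compose_def mult fun_eq_iff restrict_def)
  then show ?thesis
    by (intro group_action.intro group_hom.intro group_hom_axioms.intro group_BijGroup assms(1))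
qed

definition root_of :: "nat \<Rightarrow> int \<Rightarrow> complex" where
  "root_of k a = cis (2 * pi * of_int a / of_nat k)"

lemma root_of_simps [simp]: "cmod (root_of k a) = 1" "root_of k 0 = 1"
  by (simp_all add: root_of_def)

lemma root_of_add: "root_of k (a + b) = root_of k a * root_of k b"
  by (simp add: root_of_def cis_mult add_divide_distrib distrib_left)

lemma root_of_uminus: "root_of k (- a) = cnj (root_of k a)"
  by (simp add: root_of_def cis_cnj)

lemma root_of_power_nat:
  assumes "k > 0" shows "root_of k a ^ k = 1"
proof -
  have "root_of k a ^ k = cis (2 * pi * of_int a)"
    using assms by (simp add: root_of_def Complex.DeMoivre)
  then show ?thesis by (simp add: cis_multiple_2pi)
qed

lemma root_of_eq_1_iff:
  assumes "k > 0" shows "root_of k a = 1 \<longleftrightarrow> int k dvd a"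
proof
  assume "root_of k a = 1"
  then have "cos (2 * pi * of_int a / of_nat k) = 1" by (simp add: root_of_def complex_eq_iff)
  then obtain m :: int where "2 * pi * of_int a / of_nat k = of_int m * 2 * pi"
    unfolding cos_one_2pi_int by blast
  then have "real_of_int a = real_of_int (m * int k)" using assms by (simp add: field_simps)
  then have "a = m * int k" by (simp only: of_int_eq_iff)
  then show "int k dvd a" by simp
next
  assume "int k dvd a"
  then obtain m where "a = int k * m" by blast
  then have "2 * pi * of_int a / of_nat k = 2 * pi * of_int m" using assms by simp
  then show "root_of k a = 1" unfolding root_of_def by (simp add: cis_multiple_2pi)
qed

lemma root_of_mod: assumes "k > 0" shows "root_of k (a mod int k) = root_of k a"
proof -
  have "root_of k a = root_of k (a mod int k) * root_of k (int k * (a div int k))"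
    by (simp flip: root_of_add)
  also have "root_of k (int k * (a div int k)) = 1" using root_of_eq_1_iff[OF assms] by simp
  finally show ?thesis by simp
qed

lemma root_of_inj:
  assumes "k > 0" "root_of k a = root_of k b" "a \<in> {0..<int k}" "b \<in> {0..<int k}"
  shows "a = b"
proof -
  have "root_of k (a + - b) = 1"
    unfolding root_of_add root_of_uminus assms(2) using cnj_mult_unit[of "root_of k b"]
    by (simp add: mult.commute)
  then have "int k dvd a - b" using root_of_eq_1_iff[OF assms(1)] by simp
  then have "a mod int k = b mod int k" by (simp add: mod_eq_dvd_iff)
  then show ?thesis using assms(3,4) by simp
qed

lemma root_of_surj:
  assumes "k > 0" "Y ^ k = 1"
  obtains a where "a \<in> {0..<int k}" "root_of k a = Y"
proof -
  have "inj_on (root_of k) {0..<int k}" using root_of_inj[OF assms(1)] by (auto intro: inj_onI)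
  then have "card (root_of k ` {0..<int k}) = k" by (simp add: card_image)
  moreover have "card {Y :: complex. Y ^ k = 1} = k" using card_roots_unity_eq[of k] assms(1) by simp
  moreover have "root_of k ` {0..<int k} \<subseteq> {Y. Y ^ k = 1}" using root_of_power_nat[OF assms(1)] by auto
  ultimately have "root_of k ` {0..<int k} = {Y. Y ^ k = 1}"
    using assms(1) by (intro card_subset_eq finite_roots_unity) auto
  then have "Y \<in> root_of k ` {0..<int k}" using assms(2) by simp
  then obtain a where "a \<in> {0..<int k}" "Y = root_of k a" by (rule imageE)
  then show ?thesis using that by simp
qed

locale dihedral_action = dihedral_model \<sigma> c k
  for \<sigma> :: "'n::finite \<Rightarrow> 'n" and c k +
  fixes e :: "real^(3 + 'n) \<Rightarrow> 'p"
  assumes inj_e: "inj e"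
begin

sublocale level: regular_level_set \<Phi> \<Omega> e
  by (rule regular_level_set[OF inj_e])

abbreviation dih where "dih \<equiv> dihedral_group k"
abbreviation M where "M \<equiv> level.N"

definition move :: "int \<times> int \<Rightarrow> real^(3 + 'n) \<Rightarrow> real^(3 + 'n)" where
  "move g = act (root_of k (fst g)) (snd g \<noteq> 0)"

definition \<phi> :: "int \<times> int \<Rightarrow> 'p \<Rightarrow> 'p" where
  "\<phi> g = restrict (\<lambda>p. e (move g (level.\<epsilon> p))) (e ` M)"

lemma mem_M_iff: "q \<in> M \<longleftrightarrow> q \<in> {q \<in> \<Omega>. \<Phi> q = 0}"
  by (simp add: level.N_def)

lemma carrier_dih: "g \<in> carrier dih \<longleftrightarrow> fst g \<in> {0..<int k} \<and> (snd g = 0 \<or> snd g = 1)"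
  using k_pos by (cases g) (auto simp: dihedral_group_def carrier_integer_mod_group)

lemma one_dih: "\<one>\<^bsub>dih\<^esub> = (0, 0)"
  by (simp add: dihedral_group_def)

lemma root_of_power: "root_of k a ^ k = 1"
  by (rule root_of_power_nat[OF k_pos])

lemma snd_mult: "snd (g \<otimes>\<^bsub>dih\<^esub> h) = snd g \<otimes>\<^bsub>integer_mod_group 2\<^esub> snd h"
  by (cases g; cases h) (simp add: dihedral_group_def)

lemma move_mult:
  assumes "g \<in> carrier dih" "h \<in> carrier dih"
  shows "move (g \<otimes>\<^bsub>dih\<^esub> h) q = move g (move h q)"
proof -
  obtain a s b t where gh: "g = (a, s)" "h = (b, t)" by (metis surj_pair)
  have b: "b \<in> carrier (integer_mod_group k)"
    using assms(2) by (simp add: gh dihedral_group_def)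
  have "root_of k (fst (g \<otimes>\<^bsub>dih\<^esub> h)) = root_of k a * conj_if (s \<noteq> 0) (root_of k b)"
    using b by (auto simp: gh dihedral_group_def root_of_mod[OF k_pos] root_of_add root_of_uminus conj_if_def)
  moreover have "snd (g \<otimes>\<^bsub>dih\<^esub> h) \<noteq> 0 \<longleftrightarrow> ((s \<noteq> 0) \<noteq> (t \<noteq> 0))"
    using assms by (auto simp: snd_mult gh carrier_dih)
  ultimately show ?thesis by (simp add: move_def act_act gh)
qed

lemma move_one [simp]: "move \<one>\<^bsub>dih\<^esub> q = q"
  by (simp add: move_def one_dih)

lemma compatible_move: "level.compatible (move g)"
  unfolding move_def by (rule compatible_act[OF inj_e]) (simp_all add: root_of_power)

lemma move_M: "q \<in> M \<Longrightarrow> move g q \<in> M"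
  using compatible_move[of g] by (auto simp: level.compatible_def)

lemma \<phi>_e: "q \<in> M \<Longrightarrow> \<phi> g (e q) = e (move g q)"
  by (simp add: \<phi>_def)

lemma group_action_\<phi>: "group_action dih (e ` M) \<phi>"
  unfolding \<phi>_def[abs_def]
  by (rule group_action_restrictI) (auto simp: group_dihedral_group move_M move_mult)

lemma stabilizer_e: "q \<in> M \<Longrightarrow> stabilizer dih \<phi> (e q) = {g \<in> carrier dih. move g q = q}"
  using inj_e by (auto simp: stabilizer_def \<phi>_e dest: injD)

lemma orbit_e: "q \<in> M \<Longrightarrow> orbit dih \<phi> (e q) = e ` {move g q |g. g \<in> carrier dih}"
  by (auto simp: orbit_def \<phi>_e)

lemma special_in_M: "q \<in> lower_poles \<Longrightarrow> q \<in> M" "q \<in> upper_poles \<Longrightarrow> q \<in> M" "q \<in> rotation_poles \<Longrightarrow> q \<in> M"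
  unfolding mem_M_iff using special_points_in_level by blast+

lemma nontrivial_fixed_point:
  assumes "g \<in> carrier dih" "g \<noteq> \<one>\<^bsub>dih\<^esub>" "q \<in> M" "move g q = q"
  shows "q \<in> lower_poles \<union> upper_poles \<or> q \<in> rotation_poles \<and> k \<noteq> 1"
proof -
  have "snd g \<noteq> 0 \<or> root_of k (fst g) \<noteq> 1"
    using assms(1,2) root_of_inj[OF k_pos, of "fst g" 0] by (cases g) (auto simp: carrier_dih one_dih)
  then have "q \<in> lower_poles \<union> upper_poles \<or> q \<in> rotation_poles \<and> \<not> snd g \<noteq> 0"
    using assms(3,4) unfolding move_def mem_M_iff
    by (intro fixed_point_cases[of q "root_of k (fst g)"]) (auto simp: root_of_power)
  moreover have "k \<noteq> 1" if "snd g = 0"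
    using that assms(1,2) by (cases g) (auto simp: carrier_dih one_dih)
  ultimately show ?thesis by blast
qed

lemma move_rotation_pole: "move g (point t 0 0) = point ((if snd g \<noteq> 0 then - 1 else 1) * t) 0 0"
  if "\<bar>t\<bar> < 3"
  using that linear_0[OF linear_vec_maps(1)] linear_0[OF linear_vec_maps(4)]
  by (simp add: move_def act_def milnor_part_def milnor_act_def)

lemma move_sphere_pole: "move g (point t Y 0) = point t (root_of k (fst g) * conj_if (snd g \<noteq> 0) Y) 0"
  if "t > 3"
  using that by (simp add: move_def act_def milnor_part_def sphere_act_def)

lemma unit_root_norm: "Y ^ k = 1 \<Longrightarrow> cmod Y = 1"
  using power_eq_imp_eq_base[of "cmod Y" k 1] k_pos by (simp flip: norm_power)

lemma orbit_sphere_pole: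
  assumes "t > 3" "Y ^ k = 1" "point t Y 0 \<in> M"
  shows "orbit dih \<phi> (e (point t Y 0)) = e ` {point t Y' 0 |Y'. Y' ^ k = 1}"
proof -
  have 1: "\<exists>g \<in> carrier dih. Y' = root_of k (fst g) * conj_if (snd g \<noteq> 0) Y" if "Y' ^ k = 1" for Y'
  proof -
    have "(Y' * cnj Y) ^ k = 1" using that assms(2)
      by (simp add: power_mult_distrib flip: complex_cnj_power)
    then obtain a where "a \<in> {0..<int k}" "root_of k a = Y' * cnj Y"
      by (rule root_of_surj[OF k_pos])
    moreover have "Y' * cnj Y * Y = Y'"
      using cnj_mult_unit[OF unit_root_norm[OF assms(2)]] by (simp add: mult.assoc)
    ultimately show ?thesis by (intro bexI[of _ "(a, 0)"]) (auto simp: carrier_dih)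
  qed
  have 2: "(root_of k (fst g) * conj_if (snd g \<noteq> 0) Y) ^ k = 1" for g :: "int \<times> int"
    using assms(2) by (simp add: power_mult_distrib root_of_power flip: conj_if_simps(7))
  have "{move g (point t Y 0) |g. g \<in> carrier dih} = {point t Y' 0 |Y'. Y' ^ k = 1}"
    unfolding move_sphere_pole[OF assms(1)]
  proof (intro subset_antisym subsetI)
    fix x assume "x \<in> {point t Y' (0 :: real^'n) |Y'. Y' ^ k = 1}"
    then obtain Y' where "x = point t Y' 0" "Y' ^ k = 1" by blast
    moreover from 1[OF this(2)] obtain g where
      "g \<in> carrier dih" "Y' = root_of k (fst g) * conj_if (snd g \<noteq> 0) Y" by blast
    ultimately show "x \<in> {point t (root_of k (fst g) * conj_if (snd g \<noteq> 0) Y) 0 |g. g \<in> carrier dih}"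
      by blast
  qed (use 2 in blast)
  then show ?thesis by (simp add: orbit_e[OF assms(3)])
qed

lemma orbit_rotation_pole:
  assumes "q \<in> rotation_poles"
  shows "orbit dih \<phi> (e q) = e ` rotation_poles"
proof -
  have g: "(0, 0) \<in> carrier dih" "(0, 1) \<in> carrier dih" using k_pos by (auto simp: carrier_dih)
  obtain t :: real where t: "q = point t 0 0" "t = 2 \<or> t = - 2"
    using assms by (auto simp: rotation_poles_def)
  have "{move g q |g. g \<in> carrier dih} = rotation_poles"
  proof (intro subset_antisym subsetI)
    fix x assume "x \<in> {move g q |g. g \<in> carrier dih}"
    then show "x \<in> rotation_poles" using t by (auto simp: move_rotation_pole rotation_poles_def)
  next
    fix x assume "x \<in> rotation_poles"
    then have "x = move (0, 0) q \<or> x = move (0, 1) q"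
      using t by (auto simp: move_rotation_pole rotation_poles_def)
    then show "x \<in> {move g q |g. g \<in> carrier dih}" using g by blast
  qed
  then show ?thesis using orbit_e special_in_M(3)[OF assms] by simp
qed

text \<open>The equation for \<open>g\<close> to fix the pole over \<open>Y\<close> determines the rotation part of \<open>g\<close> in each of the two cosets of
the rotations: it is trivial for a rotation and given by the root \<open>Y\<^sup>2\<close> for a reflection.\<close>
lemma stabilizer_sphere_pole:
  assumes "t > 3" "Y ^ k = 1" "point t Y 0 \<in> M"
  shows "bij_betw snd (stabilizer dih \<phi> (e (point t Y 0))) {0, 1}"
proof -
  let ?S = "{g \<in> carrier dih. root_of k (fst g) * conj_if (snd g \<noteq> 0) Y = Y}"
  have S: "stabilizer dih \<phi> (e (point t Y 0)) = ?S"
    unfolding stabilizer_e[OF assms(3)] move_sphere_pole[OF assms(1)] by (auto simp: coordinates_eq_iff)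
  have "Y \<noteq> 0" using assms(2) k_pos by (auto simp: power_0_left)
  have "inj_on snd ?S"
  proof (rule inj_onI)
    fix g h assume *: "g \<in> ?S" "h \<in> ?S" "snd g = snd h"
    then have "root_of k (fst g) * conj_if (snd g \<noteq> 0) Y = root_of k (fst h) * conj_if (snd g \<noteq> 0) Y"
      by simp
    moreover have "conj_if (snd g \<noteq> 0) Y \<noteq> 0" using \<open>Y \<noteq> 0\<close> by (simp add: conj_if_def)
    ultimately have "root_of k (fst g) = root_of k (fst h)" by simp
    then have "fst g = fst h" using root_of_inj[OF k_pos] * by (simp add: carrier_dih)
    then show "g = h" using * by (simp add: prod_eq_iff)
  qed
  moreover have "snd ` ?S = {0, 1}"
  proof -
    have "(Y * Y) ^ k = 1" using assms(2) by (simp add: power_mult_distrib)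
    then obtain a where a: "a \<in> {0..<int k}" "root_of k a = Y * Y"
      by (rule root_of_surj[OF k_pos])
    have "Y * Y * cnj Y = Y"
      using cnj_mult_unit[OF unit_root_norm[OF assms(2)]] by (simp add: mult_ac)
    then have "(a, 1) \<in> ?S" "(0, 0) \<in> ?S"
      using a k_pos by (auto simp: carrier_dih conj_if_def)
    then have "{0, 1} \<subseteq> snd ` ?S" by force
    moreover have "snd ` ?S \<subseteq> {0, 1}" by (auto simp: carrier_dih)
    ultimately show ?thesis by blast
  qed
  ultimately show ?thesis unfolding S bij_betw_def by blast
qed

lemma isotropy_sphere_pole:
  assumes "t > 3" "Y ^ k = 1" "point t Y 0 \<in> M"
  shows "dih\<lparr>carrier := stabilizer dih \<phi> (e (point t Y 0))\<rparr> \<cong> integer_mod_group 2"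
proof -
  have c2: "carrier (integer_mod_group 2) = {0, 1}" by (auto simp: carrier_integer_mod_group)
  have "snd \<in> iso (dih\<lparr>carrier := stabilizer dih \<phi> (e (point t Y 0))\<rparr>) (integer_mod_group 2)"
    using stabilizer_sphere_pole[OF assms] by (auto simp: iso_def hom_def c2 snd_mult bij_betw_def)
  then show ?thesis unfolding is_iso_def by blast
qed

lemma stabilizer_rotation_pole:
  assumes "q \<in> rotation_poles"
  shows "stabilizer dih \<phi> (e q) = {g \<in> carrier dih. snd g = 0}"
proof -
  obtain t :: real where t: "q = point t 0 0" "t = 2 \<or> t = - 2"
    using assms by (auto simp: rotation_poles_def)
  have "move g q = q \<longleftrightarrow> snd g = 0" for g
    using t(2) unfolding t(1) by (auto simp: move_rotation_pole point_eq_iff split: if_splits)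
  then show ?thesis using stabilizer_e[OF special_in_M(3)[OF assms]] by simp
qed

lemma isotropy_rotation_pole:
  assumes "q \<in> rotation_poles"
  shows "dih\<lparr>carrier := stabilizer dih \<phi> (e q)\<rparr> \<cong> integer_mod_group k"
proof -
  have "fst \<in> hom (dih\<lparr>carrier := stabilizer dih \<phi> (e q)\<rparr>) (integer_mod_group k)"
    using k_pos unfolding stabilizer_rotation_pole[OF assms]
    by (auto simp: hom_def carrier_dih carrier_integer_mod_group) (auto simp: dihedral_group_def)
  moreover have "bij_betw fst {g \<in> carrier dih. snd g = 0} {0..<int k}"
    by (rule bij_betw_byWitness[where f' = "\<lambda>a. (a, 0)"]) (auto simp: carrier_dih)
  ultimately have "fst \<in> iso (dih\<lparr>carrier := stabilizer dih \<phi> (e q)\<rparr>) (integer_mod_group k)"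
    using k_pos by (simp add: iso_def stabilizer_rotation_pole[OF assms] carrier_integer_mod_group)
  then show ?thesis unfolding is_iso_def by blast
qed

lemma orbit_lower_poles: assumes "q \<in> lower_poles" shows "orbit dih \<phi> (e q) = e ` lower_poles"
proof -
  obtain Y where "q = point 4 Y 0" "Y ^ k = 1" using assms by (auto simp: lower_poles_def)
  then show ?thesis using orbit_sphere_pole[of 4 Y] special_in_M(1)[OF assms] by (simp add: lower_poles_def)
qed

lemma orbit_upper_poles: assumes "q \<in> upper_poles" shows "orbit dih \<phi> (e q) = e ` upper_poles"
proof -
  obtain Y where "q = point 6 Y 0" "Y ^ k = 1" using assms by (auto simp: upper_poles_def)
  then show ?thesis using orbit_sphere_pole[of 6 Y] special_in_M(2)[OF assms] by (simp add: upper_poles_def)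
qed

lemma special_nonempty: "point 4 1 0 \<in> lower_poles" "point 6 1 0 \<in> upper_poles" "point 2 0 0 \<in> rotation_poles"
  by (auto simp: lower_poles_def upper_poles_def rotation_poles_def)

lemma special_orbits:
  "e ` lower_poles \<in> orbits dih (e ` M) \<phi>" "e ` upper_poles \<in> orbits dih (e ` M) \<phi>" "e ` rotation_poles \<in> orbits dih (e ` M) \<phi>"
proof -
  have *: "O' \<in> orbits dih (e ` M) \<phi>" if "q \<in> M" "orbit dih \<phi> (e q) = O'" for q O'
    using that by (auto simp: orbits_def)
  note ne = special_nonempty
  show "e ` lower_poles \<in> orbits dih (e ` M) \<phi>" by (rule *[OF special_in_M(1)[OF ne(1)] orbit_lower_poles[OF ne(1)]])
  show "e ` upper_poles \<in> orbits dih (e ` M) \<phi>" by (rule *[OF special_in_M(2)[OF ne(2)] orbit_upper_poles[OF ne(2)]])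
  show "e ` rotation_poles \<in> orbits dih (e ` M) \<phi>" by (rule *[OF special_in_M(3)[OF ne(3)] orbit_rotation_pole[OF ne(3)]])
qed

lemma nontrivial_stabilizer_poles:
  assumes "q \<in> lower_poles \<union> upper_poles"
  shows "stabilizer dih \<phi> (e q) \<noteq> {\<one>\<^bsub>dih\<^esub>}"
proof -
  obtain t :: real and Y where q: "q = point t Y 0" "t > 3" "Y ^ k = 1"
    using assms by (force simp: lower_poles_def upper_poles_def)
  have "snd ` stabilizer dih \<phi> (e q) = {0, 1}"
    using stabilizer_sphere_pole[OF q(2,3)] special_in_M assms q(1) by (auto simp: bij_betw_def)
  then show ?thesis by (auto simp: one_dih)
qed

text \<open>For \<open>k = 1\<close> there are no nontrivial rotations, and the orbit of the rotation poles is free.\<close>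
lemma singular_orbits_eq:
  "singular_orbits dih (e ` M) \<phi> = {e ` lower_poles, e ` upper_poles} \<union> (if k = 1 then {} else {e ` rotation_poles})"
proof (intro subset_antisym subsetI)
  fix O' assume "O' \<in> singular_orbits dih (e ` M) \<phi>"
  then obtain q where q: "q \<in> M" "O' = orbit dih \<phi> (e q)"
    and ne: "\<And>x. x \<in> O' \<Longrightarrow> stabilizer dih \<phi> x \<noteq> {\<one>\<^bsub>dih\<^esub>}"
    by (auto simp: singular_orbits_def orbits_def)
  have "e q \<in> O'"
    using group_action.orbit_refl[OF group_action_\<phi>] q by blast
  then have "stabilizer dih \<phi> (e q) \<noteq> {\<one>\<^bsub>dih\<^esub>}" by (rule ne)
  moreover have "\<one>\<^bsub>dih\<^esub> \<in> stabilizer dih \<phi> (e q)"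
    using k_pos q(1) by (simp add: stabilizer_e) (simp add: carrier_dih one_dih)
  ultimately obtain g where "g \<in> stabilizer dih \<phi> (e q)" "g \<noteq> \<one>\<^bsub>dih\<^esub>" by blast
  then have "q \<in> lower_poles \<union> upper_poles \<or> q \<in> rotation_poles \<and> k \<noteq> 1"
    using nontrivial_fixed_point[of g q] q(1) by (auto simp: stabilizer_e)
  then show "O' \<in> {e ` lower_poles, e ` upper_poles} \<union> (if k = 1 then {} else {e ` rotation_poles})"
    using q(2) orbit_lower_poles orbit_upper_poles orbit_rotation_pole by auto
next
  fix O' assume "O' \<in> {e ` lower_poles, e ` upper_poles} \<union> (if k = 1 then {} else {e ` rotation_poles})"
  then consider "O' = e ` lower_poles" | "O' = e ` upper_poles" | "O' = e ` rotation_poles" "k \<noteq> 1" by (auto split: if_splits)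
  then show "O' \<in> singular_orbits dih (e ` M) \<phi>"
  proof cases
    case 1
    then show ?thesis
      using special_orbits(1) nontrivial_stabilizer_poles by (auto simp: singular_orbits_def)
  next
    case 2
    then show ?thesis
      using special_orbits(2) nontrivial_stabilizer_poles by (auto simp: singular_orbits_def)
  next
    case 3
    have "(1, 0) \<in> {g \<in> carrier dih. snd g = 0}" using 3 k_pos by (auto simp: carrier_dih)
    then have "stabilizer dih \<phi> (e q) \<noteq> {\<one>\<^bsub>dih\<^esub>}" if "q \<in> rotation_poles" for q
      unfolding stabilizer_rotation_pole[OF that] one_dih by (metis prod.inject singletonD zero_neq_one)
    then show ?thesis using 3 special_orbits(3) by (auto simp: singular_orbits_def)
  qed
qed

lemma singular_orbits_of_types: "singular_orbits_of_types dih (e ` M) \<phi> [2, 2, k]"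
  unfolding singular_orbits_of_types_def
proof (intro exI[of _ "[e ` lower_poles, e ` upper_poles, e ` rotation_poles]"] conjI)
  show "distinct [e ` lower_poles, e ` upper_poles, e ` rotation_poles]"
  proof -
    have "point 4 1 0 \<notin> upper_poles" "point 4 1 0 \<notin> rotation_poles" "point 6 1 0 \<notin> rotation_poles"
      by (auto simp: upper_poles_def rotation_poles_def point_eq_iff)
    then have "lower_poles \<noteq> upper_poles" "lower_poles \<noteq> rotation_poles" "upper_poles \<noteq> rotation_poles" using special_nonempty by blast+
    then show ?thesis using inj_e by (simp add: inj_image_eq_iff)
  qed
  show "set [e ` lower_poles, e ` upper_poles, e ` rotation_poles] \<subseteq> orbits dih (e ` M) \<phi>"
    using special_orbits by simp
  have "point 4 Y 0 \<in> M" "point 6 Y 0 \<in> M" if "Y ^ k = 1" for Y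
    using that special_in_M(1)[of "point 4 Y 0"] special_in_M(2)[of "point 6 Y 0"]
    by (auto simp: lower_poles_def upper_poles_def)
  then have "has_cyclic_isotropy dih \<phi> (e ` lower_poles) 2" "has_cyclic_isotropy dih \<phi> (e ` upper_poles) 2"
    "has_cyclic_isotropy dih \<phi> (e ` rotation_poles) k"
    using isotropy_sphere_pole[of 4] isotropy_sphere_pole[of 6] isotropy_rotation_pole
    by (auto simp: has_cyclic_isotropy_def lower_poles_def upper_poles_def)
  then show "\<forall>i<length [2, 2, k]. has_cyclic_isotropy dih \<phi> ([e ` lower_poles, e ` upper_poles, e ` rotation_poles] ! i) ([2, 2, k] ! i)"
    by (auto simp: less_Suc_eq numeral_3_eq_3)
  have "{[e ` lower_poles, e ` upper_poles, e ` rotation_poles] ! i |i. i < length [2, 2, k] \<and> [2, 2, k] ! i \<noteq> 1} =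
      {e ` lower_poles, e ` upper_poles} \<union> (if k = 1 then {} else {e ` rotation_poles})"
    (is "?L = ?R")
  proof -
    have "{i. i < length [2, 2, k] \<and> [2, 2, k] ! i \<noteq> 1} = {0, 1} \<union> (if k = 1 then {} else {2})"
      by (auto simp: less_Suc_eq)
    then have "?L = (!) [e ` lower_poles, e ` upper_poles, e ` rotation_poles] ` ({0, 1} \<union> (if k = 1 then {} else {2}))"
      by blast
    then show ?thesis by simp
  qed
  then show "singular_orbits dih (e ` M) \<phi> =
      {[e ` lower_poles, e ` upper_poles, e ` rotation_poles] ! i |i. i < length [2, 2, k] \<and> [2, 2, k] ! i \<noteq> 1}"
    using singular_orbits_eq by simp
qed simp

text \<open>Nontrivial elements have only finitely many fixed points, and finite subspaces of a Hausdorff space are discrete.\<close>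
lemma pseudofree: "pseudofree_action dih level.X \<phi>"
  unfolding pseudofree_action_def
proof (intro ballI impI)
  fix g assume g: "g \<in> carrier dih" "g \<noteq> \<one>\<^bsub>dih\<^esub>"
  let ?F = "invariants (topspace level.X) \<phi> g"
  have "?F \<subseteq> e ` (lower_poles \<union> upper_poles \<union> rotation_poles)"
  proof
    fix x assume "x \<in> ?F"
    then obtain q where q: "x = e q" "q \<in> M" "\<phi> g (e q) = e q"
      by (auto simp: invariants_def level.topspace_X)
    then have "move g q = q" using inj_e by (auto simp: \<phi>_e dest: injD)
    then show "x \<in> e ` (lower_poles \<union> upper_poles \<union> rotation_poles)" using nontrivial_fixed_point[OF g q(2)] q(1) by blast
  qed
  then have "finite ?F" using finite_special finite_subset by blast
  moreover have "topspace (subtopology level.X ?F) = ?F" by (auto simp: invariants_def)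
  ultimately show "subtopology level.X ?F = discrete_topology ?F"
    using Hausdorff_space_subtopology[OF level.X_space_properties(1)]
    by (intro finite_topspace_imp_discrete_topology)
qed

lemma smooth_self_map_\<phi>: "smooth_self_map level.X level.atlas (\<phi> g)"
  by (rule level.smooth_self_map_compatible[OF compatible_move]) (simp add: \<phi>_e)

lemma preserves_orientation_\<phi>: "preserves_orientation level.atlas (\<phi> g)"
  by (rule level.preserves_orientation_compatible[OF compatible_move]) (simp add: \<phi>_e)

end

lemma exists_injection_into_sequences: "\<exists>e :: real^'m::finite \<Rightarrow> (nat \<Rightarrow> real). inj e"
proof -
  obtain f :: "'m \<Rightarrow> nat" where f: "inj f"
    using finite_imp_inj_to_nat_seg[of "UNIV :: 'm set"] by auto
  have "inj (\<lambda>v :: real^'m. \<lambda>i. v $ inv_into UNIV f i)"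
  proof (rule injI)
    fix v w :: "real^'m"
    assume "(\<lambda>i. v $ inv_into UNIV f i) = (\<lambda>i. w $ inv_into UNIV f i)"
    then have "v $ inv_into UNIV f (f j) = w $ inv_into UNIV f (f j)" for j by (rule fun_cong)
    then show "v = w" using f by (simp add: vec_eq_iff)
  qed
  then show ?thesis by blast
qed

theorem theorem1p3:
  fixes k :: nat
  assumes "CARD('n::finite) mod 4 = 2"
    and "odd k" and "k > 0"
  shows "\<exists>(X :: (nat \<Rightarrow> real) topology) (A :: (nat \<Rightarrow> real, 'n) chart set)
            (\<phi> :: int \<times> int \<Rightarrow> (nat \<Rightarrow> real) \<Rightarrow> (nat \<Rightarrow> real)).
           closed_smooth_manifold X A \<and>
           orientable X A \<and>
           smooth_action (dihedral_group k) X A \<phi> \<and>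
           pseudofree_action (dihedral_group k) X \<phi> \<and>
           orientation_preserving_action (dihedral_group k) X A \<phi> \<and>
           singular_orbits_of_types (dihedral_group k) (topspace X) \<phi> [2, 2, k]"
proof -
  obtain \<sigma> :: "'n \<Rightarrow> 'n" and c where "paired_coordinates \<sigma> c" "(\<Prod>i\<in>UNIV. c i) = - 1"
    using exists_paired_coordinates[OF assms(1)] by blast
  moreover have "even CARD('n)" using assms(1) by presburger
  ultimately have "dihedral_model \<sigma> c k"
    using assms(2) by (intro dihedral_model.intro dihedral_model_axioms.intro)
  moreover obtain e :: "real^(3 + 'n) \<Rightarrow> (nat \<Rightarrow> real)" where "inj e"
    using exists_injection_into_sequences by blast
  ultimately interpret dihedral_action \<sigma> c k e
    by (intro dihedral_action.intro dihedral_action_axioms.intro)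
  have "orientable level.X level.atlas"
    unfolding orientable_def using level.orientation_of_atlas by blast
  moreover have "smooth_action dih level.X level.atlas \<phi>"
    using group_action_\<phi> smooth_self_map_\<phi> by (simp add: smooth_action_def level.topspace_X)
  moreover have "orientation_preserving_action dih level.X level.atlas \<phi>"
    unfolding orientation_preserving_action_def
    using level.orientation_of_atlas preserves_orientation_\<phi> by blast
  moreover have "singular_orbits_of_types dih (topspace level.X) \<phi> [2, 2, k]"
    using singular_orbits_of_types by (simp add: level.topspace_X)
  ultimately show ?thesis
    using level.closed_smooth_manifold pseudofree by blast
qed

end
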